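(* Let $N=(P,S)$ be a rigid translational spring network in dimension $2$ with $n$ nodes and $s$ springs, and for an ordered pair of distinct nodes $(p_i,p_j)$ (the base points) let $B_f(p_i,p_j)$ and $B_i(p_i,p_j)$ denote the Bézout bounds of, respectively, the standard system and the inverse-length system of $N$ with base points $p_i,p_j$. Then: (a) The Bézout bound for the standard formulation depends in general on the choice of base points (that is, there are networks for which $B_f(p_i,p_j)$ is not constant in $(p_i,p_j)$). For every such $N$, $B_f(p_i,p_j)$ is minimized, over all ordered pairs of distinct nodes, when $p_i$ is chosen to be a node of largest degree in $P$ and $p_j$ is chosen to be a node of largest degree among $P\setminus\{p_i\}$. (b) The Bézout bound for the inverse-length formulation, $B_i(p_i,p_j)$, is independent of the choice of base points.
   Context: A translational spring network is a pair $N=(P,S)$ consisting of a finite set of nodes $P=\{p_1,\dots,p_n\}$, $n\ge 2$, and a set of springs $S\subseteq\{s_{a,b}: 1\le a<b\le n\}$, where $s_{a,b}$ connects $p_a$ and $p_b$. The notation is symmetric: $s_{b,a}=s_{a,b}$, and likewise for all quantities indexed by springs. Each spring $s_{a,b}\in S$ comes with a spring constant $k_{a,b}>0$ and a resting length $\tilde\ell_{a,b}>0$ (known real parameters). The degree $d(p_a)$ of a node is the number of springs incident to it. An embedding of $N$ into $\mathbb{R}^2$ assigns to each $p_a$ a point $(x_a,y_a)\in\mathbb{R}^2$, and this determines the stretched lengths $\ell_{a,b}$ as the Euclidean distances between the points assigned to $p_a$ and $p_b$. By Hooke's law, the spring $s_{a,b}$ exerts on $p_a$ the force $k_{a,b}(\ell_{a,b}-\tilde\ell_{a,b})\frac{1}{\ell_{a,b}}(x_b-x_a,\,y_b-y_a)$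 (defined when $\ell_{a,b}\neq 0$). An embedding is an equilibrium position if for every node the net force from all incident springs is defined and equal to $0$. The network is rigid (in dimension $2$) if it has finitely many equilibrium positions up to rotations and translations. The standard system of $N$ (before fixing base points) is the system of polynomials (set equal to $0$) in the variables $x_1,\dots,x_n,y_1,\dots,y_n$ and $\ell_{a,b}$ ($s_{a,b}\in S$): (1) for each $s_{a,b}\in S$, the geometric equation $(x_b-x_a)^2+(y_b-y_a)^2-\ell_{a,b}^2=0$; (2) for each node $p_a$, the force equations in the $x$- and $y$-directions $$\sum_{b:\,s_{a,b}\in S} k_{a,b}(\ell_{a,b}-\tilde\ell_{a,b})(x_b-x_a)\prod_{m\ne b:\, s_{a,m}\in S}\ell_{a,m}=0,\qquad \sum_{b:\,s_{a,b}\in S} k_{a,b}(\ell_{a,b}-\tilde\ell_{a,b})(y_b-y_a)\prod_{m\ne b:\, s_{a,m}\in S}\ell_{a,m}=0.$$ The inverse-length system of $N$ (before fixing base points) is the system of polynomials in the variables $x_1,\dots,x_n,y_1,\dots,y_n$ and $I_{a,b}$ ($s_{a,b}\in S$), where $I_{a,b}$ represents $1/\ell_{a,b}$: (1) for each $s_{a,b}\in S$, the geometric equation $\left((x_b-x_a)^2+(y_b-y_a)^2\right)I_{a,b}^2-1=0$; (2) for each node $p_a$, the force equations in the $x$- and $y$-directions $$\sum_{b:\,s_{a,b}\in S} k_{a,b}(1-\tilde\ell_{a,b}I_{a,b})(x_b-x_a)=0,\qquad \sum_{b:\,s_{a,b}\in S} k_{a,b}(1-\tilde\ell_{a,b}I_{a,b})(y_b-y_a)=0.$$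 Fixing base points: for an ordered pair of distinct nodes $(p_i,p_j)$, the standard (resp. inverse-length) system with base points $p_i,p_j$ is obtained from the standard (resp. inverse-length) system of $N$ before fixing base points, consisting of one geometric equation for each spring and two force equations for each node, by fixing $p_i=(0,0)$ and $p_j=(x_j,0)$, i.e. substituting $x_i=y_i=y_j=0$ (so these three are no longer variables), and removing three equations: both force equations at $p_i$ and the $y$-direction force equation at $p_j$. All geometric equations and all other force equations are kept. The Bézout bound of a system of polynomial equations is the product of the total degrees (in the variables, not the parameters) of all polynomials in the system. *)

theory Defs
  imports "HOL-Analysis.Analysis" "HOL-Library.Poly_Mapping"
begin

section \<open>Translational spring networks\<close>

text \<open>The node \<open>p\<^sub>a\<close> is represented by its index \<open>a \<in> {1..n}\<close> and the spring
  \<open>s\<^sub>a\<^sub>,\<^sub>b\<close> by the unordered pair \<open>{a, b}\<close>, so that every quantity indexed by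
  springs is symmetric in \<open>a, b\<close>.\<close>

record spring_network =
  num_nodes :: nat
  springs :: "nat set set"
  spring_const :: "nat set \<Rightarrow> real"
  rest_length :: "nat set \<Rightarrow> real"

definition nodes :: "spring_network \<Rightarrow> nat set" where
  "nodes N = {1..num_nodes N}"

definition translational_spring_network :: "spring_network \<Rightarrow> bool" where
  "translational_spring_network N \<longleftrightarrow>
     2 \<le> num_nodes N \<and>
     springs N \<subseteq> {{a, b} | a b. 1 \<le> a \<and> a < b \<and> b \<le> num_nodes N} \<and>
     (\<forall>s \<in> springs N. 0 < spring_const N s \<and> 0 < rest_length N s)"

definition node_degree :: "spring_network \<Rightarrow> nat \<Rightarrow> nat" where
  "node_degree N a = card {s \<in> springs N. a \<in> s}"

definition neighbours :: "spring_network \<Rightarrow> nat \<Rightarrow> nat set" where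
  "neighbours N a = {b. {a, b} \<in> springs N}"


section \<open>Equilibrium positions and rigidity\<close>

text \<open>Embeddings are taken extensional (\<open>undefined\<close> outside the nodes), so that two
  embeddings are equal iff they place every node at the same point.\<close>

definition embeddings :: "spring_network \<Rightarrow> (nat \<Rightarrow> real^2) set" where
  "embeddings N = nodes N \<rightarrow>\<^sub>E UNIV"

text \<open>The force exerted on \<open>p\<^sub>a\<close> by the spring joining it to \<open>p\<^sub>b\<close>; meaningful
  only if \<open>p a \<noteq> p b\<close>, which \<open>equilibrium\<close> requires separately.\<close>

definition hooke_force :: "spring_network \<Rightarrow> (nat \<Rightarrow> real^2) \<Rightarrow> nat \<Rightarrow> nat \<Rightarrow> real^2" where
  "hooke_force N p a b =
     (spring_const N {a, b} * (dist (p a) (p b) - rest_length N {a, b}) * (1 / dist (p a) (p b)))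
       *\<^sub>R (p b - p a)"

definition equilibrium :: "spring_network \<Rightarrow> (nat \<Rightarrow> real^2) \<Rightarrow> bool" where
  "equilibrium N p \<longleftrightarrow>
     (\<forall>a \<in> nodes N. (\<forall>b \<in> neighbours N a. p a \<noteq> p b) \<and>
        (\<Sum>b \<in> neighbours N a. hooke_force N p a b) = 0)"

definition equilibria :: "spring_network \<Rightarrow> (nat \<Rightarrow> real^2) set" where
  "equilibria N = {p \<in> embeddings N. equilibrium N p}"

definition same_up_to_motion ::
    "spring_network \<Rightarrow> ((nat \<Rightarrow> real^2) \<times> (nat \<Rightarrow> real^2)) set" where
  "same_up_to_motion N = {(p, q). p \<in> equilibria N \<and> q \<in> equilibria N \<and>
     (\<exists>(R :: real^2^2) t. rotation_matrix R \<and> (\<forall>a \<in> nodes N. q a = R *v p a + t))}"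

definition rigid :: "spring_network \<Rightarrow> bool" where
  "rigid N \<longleftrightarrow> finite (equilibria N // same_up_to_motion N)"


section \<open>Multivariate polynomials\<close>

text \<open>A monomial maps each variable to its exponent and a polynomial maps each monomial to its
  coefficient; multiplication is the convolution product of Poly_Mapping.\<close>

datatype var = X nat | Y nat | Len "nat set" | InvLen "nat set"

type_synonym rpoly = "(var \<Rightarrow>\<^sub>0 nat) \<Rightarrow>\<^sub>0 real"

definition Var :: "var \<Rightarrow> rpoly" where
  "Var v = Poly_Mapping.single (Poly_Mapping.single v 1) 1"

definition Const :: "real \<Rightarrow> rpoly" where
  "Const c = Poly_Mapping.single 0 c"

definition monomial_degree :: "(var \<Rightarrow>\<^sub>0 nat) \<Rightarrow> nat" where
  "monomial_degree m = (\<Sum>v \<in> Poly_Mapping.keys m. Poly_Mapping.lookup m v)"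

text \<open>The zero polynomial gets degree 0 by convention.\<close>

definition total_degree :: "rpoly \<Rightarrow> nat" where
  "total_degree p = Max (insert 0 (monomial_degree ` Poly_Mapping.keys p))"

definition substitute :: "(var \<Rightarrow> rpoly) \<Rightarrow> rpoly \<Rightarrow> rpoly" where
  "substitute \<sigma> p = (\<Sum>m \<in> Poly_Mapping.keys p. Const (Poly_Mapping.lookup p m) *
     (\<Prod>v \<in> Poly_Mapping.keys m. \<sigma> v ^ Poly_Mapping.lookup m v))"


section \<open>The polynomial systems\<close>

text \<open>A system is a finite set of equation labels together with a polynomial for each label, so
  that polynomials are counted with multiplicity.\<close>

datatype equation = Geometric "nat set" | ForceX nat | ForceY nat

definition equations :: "spring_network \<Rightarrow> equation set" where
  "equations N = Geometric ` springs N \<union> ForceX ` nodes N \<union> ForceY ` nodes N"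

definition standard_force :: "spring_network \<Rightarrow> (nat \<Rightarrow> var) \<Rightarrow> nat \<Rightarrow> rpoly" where
  "standard_force N Z a =
     (\<Sum>b \<in> neighbours N a.
        Const (spring_const N {a, b}) * (Var (Len {a, b}) - Const (rest_length N {a, b})) *
        (Var (Z b) - Var (Z a)) *
        (\<Prod>m \<in> neighbours N a - {b}. Var (Len {a, m})))"

definition inverse_length_force :: "spring_network \<Rightarrow> (nat \<Rightarrow> var) \<Rightarrow> nat \<Rightarrow> rpoly" where
  "inverse_length_force N Z a =
     (\<Sum>b \<in> neighbours N a.
        Const (spring_const N {a, b}) *
        (1 - Const (rest_length N {a, b}) * Var (InvLen {a, b})) *
        (Var (Z b) - Var (Z a)))"

text \<open>For a spring \<open>s = {a, b}\<close> with \<open>a < b\<close> one has \<open>a = Min s\<close> and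
  \<open>b = Max s\<close>.\<close>

definition squared_distance :: "nat set \<Rightarrow> rpoly" where
  "squared_distance s =
     (Var (X (Max s)) - Var (X (Min s)))\<^sup>2 + (Var (Y (Max s)) - Var (Y (Min s)))\<^sup>2"

fun standard_system :: "spring_network \<Rightarrow> equation \<Rightarrow> rpoly" where
  "standard_system N (Geometric s) = squared_distance s - (Var (Len s))\<^sup>2"
| "standard_system N (ForceX a) = standard_force N X a"
| "standard_system N (ForceY a) = standard_force N Y a"

fun inverse_length_system :: "spring_network \<Rightarrow> equation \<Rightarrow> rpoly" where
  "inverse_length_system N (Geometric s) = squared_distance s * (Var (InvLen s))\<^sup>2 - 1"
| "inverse_length_system N (ForceX a) = inverse_length_force N X a"
| "inverse_length_system N (ForceY a) = inverse_length_force N Y a"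


section \<open>Base points and Bezout bounds\<close>

definition based_equations :: "spring_network \<Rightarrow> nat \<Rightarrow> nat \<Rightarrow> equation set" where
  "based_equations N i j = equations N - {ForceX i, ForceY i, ForceY j}"

definition fix_base_points :: "nat \<Rightarrow> nat \<Rightarrow> rpoly \<Rightarrow> rpoly" where
  "fix_base_points i j = substitute (\<lambda>v. if v \<in> {X i, Y i, Y j} then 0 else Var v)"

definition bezout_bound :: "equation set \<Rightarrow> (equation \<Rightarrow> rpoly) \<Rightarrow> nat" where
  "bezout_bound E F = (\<Prod>e \<in> E. total_degree (F e))"

definition B_standard :: "spring_network \<Rightarrow> nat \<Rightarrow> nat \<Rightarrow> nat" where
  "B_standard N i j =
     bezout_bound (based_equations N i j) (\<lambda>e. fix_base_points i j (standard_system N e))"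

definition B_inverse :: "spring_network \<Rightarrow> nat \<Rightarrow> nat \<Rightarrow> nat" where
  "B_inverse N i j =
     bezout_bound (based_equations N i j) (\<lambda>e. fix_base_points i j (inverse_length_system N e))"

definition base_pairs :: "spring_network \<Rightarrow> (nat \<times> nat) set" where
  "base_pairs N = {(i, j). i \<in> nodes N \<and> j \<in> nodes N \<and> i \<noteq> j}"

end

theory Submission
  imports Defs "HOL-Computational_Algebra.Polynomial"
begin

text \<open>After fixing base points, a force equation at a node of degree \<open>d > 0\<close> has total degree
  \<open>d + 1\<close> in the standard system and \<open>2\<close> in the inverse-length system, while all geometric
  equations have degree \<open>2\<close> and \<open>4\<close>, respectively. Hence the standard bound is smallest when the
  removed force equations belong to nodes of largest degree, and the inverse-length bound is
  constant as long as no node is isolated, since the force equations of an isolated node are the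
  zero polynomial. Isolated nodes are excluded by rigidity: a configuration of minimal elastic
  energy exists and is an equilibrium, and an isolated node could be moved freely in it. Dependence
  on the base points is witnessed by the complete graph on four nodes minus an edge, where for each
  combination of shapes of the two triangles sharing the edge between the nodes of degree 3 the
  force balance is a linear equation that determines the length of that edge.\<close>

section \<open>Evaluation and total degree of polynomials\<close>

definition eval_monomial :: "(var \<Rightarrow> 'a::comm_ring_1) \<Rightarrow> (var \<Rightarrow>\<^sub>0 nat) \<Rightarrow> 'a" where
  "eval_monomial \<sigma> m = (\<Prod>v \<in> Poly_Mapping.keys m. \<sigma> v ^ Poly_Mapping.lookup m v)"

text \<open>The coefficient map \<open>h\<close> is a parameter so that the same homomorphism laws
  serve both substitution of polynomials (\<open>h = Const\<close>) and restriction to a line, with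
  values in \<open>real poly\<close>.\<close>

definition eval_poly :: "(real \<Rightarrow> 'a::comm_ring_1) \<Rightarrow> (var \<Rightarrow> 'a) \<Rightarrow> rpoly \<Rightarrow> 'a" where
  "eval_poly h \<sigma> p =
     (\<Sum>m \<in> Poly_Mapping.keys p. h (Poly_Mapping.lookup p m) * eval_monomial \<sigma> m)"

lemma eval_monomial_superset:
  assumes "finite A" "Poly_Mapping.keys m \<subseteq> A"
  shows "eval_monomial \<sigma> m = (\<Prod>v \<in> A. \<sigma> v ^ Poly_Mapping.lookup m v)"
  unfolding eval_monomial_def
  by (rule prod.mono_neutral_left) (use assms in \<open>auto simp: in_keys_iff\<close>)

lemma eval_monomial_zero [simp]: "eval_monomial \<sigma> 0 = 1"
  by (simp add: eval_monomial_def)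

lemma eval_monomial_add: "eval_monomial \<sigma> (m + m') = eval_monomial \<sigma> m * eval_monomial \<sigma> m'"
proof -
  let ?A = "Poly_Mapping.keys m \<union> Poly_Mapping.keys m'"
  have "Poly_Mapping.keys (m + m') \<subseteq> ?A" by (rule Poly_Mapping.keys_add)
  then show ?thesis
    by (simp add: eval_monomial_superset[of ?A] lookup_add power_add prod.distrib)
qed

lemma sum_monomials:
  "p = (\<Sum>m \<in> Poly_Mapping.keys p. Poly_Mapping.single m (Poly_Mapping.lookup p m))"
  by (rule poly_mapping_eqI) (auto simp: lookup_sum lookup_single when_def in_keys_iff)

locale coeff_hom =
  fixes h :: "real \<Rightarrow> 'a::comm_ring_1"
  assumes hom_one: "h 1 = 1"
    and hom_add: "h (x + y) = h x + h y"
    and hom_mult: "h (x * y) = h x * h y"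
begin

lemma hom_zero: "h 0 = 0"
  using hom_add[of 0 0] by simp

lemma hom_uminus: "h (- x) = - h x"
  using hom_add[of x "- x"] by (simp add: hom_zero eq_neg_iff_add_eq_0 add.commute)

lemma eval_poly_superset:
  assumes "finite A" "Poly_Mapping.keys p \<subseteq> A"
  shows "eval_poly h \<sigma> p = (\<Sum>m \<in> A. h (Poly_Mapping.lookup p m) * eval_monomial \<sigma> m)"
  unfolding eval_poly_def
  by (rule sum.mono_neutral_left) (use assms in \<open>auto simp: in_keys_iff hom_zero\<close>)

lemma eval_poly_add: "eval_poly h \<sigma> (p + q) = eval_poly h \<sigma> p + eval_poly h \<sigma> q"
proof -
  let ?A = "Poly_Mapping.keys p \<union> Poly_Mapping.keys q"
  have "Poly_Mapping.keys (p + q) \<subseteq> ?A" by (rule Poly_Mapping.keys_add)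
  then show ?thesis
    by (simp add: eval_poly_superset[of ?A] lookup_add hom_add ring_distribs sum.distrib)
qed

lemma eval_poly_zero: "eval_poly h \<sigma> 0 = 0"
  by (simp add: eval_poly_def)

lemma eval_poly_uminus: "eval_poly h \<sigma> (- p) = - eval_poly h \<sigma> p"
  by (simp add: eval_poly_def hom_uminus sum_negf)

lemma eval_poly_diff: "eval_poly h \<sigma> (p - q) = eval_poly h \<sigma> p - eval_poly h \<sigma> q"
  using eval_poly_add[of \<sigma> p "- q"] by (simp add: eval_poly_uminus)

lemma eval_poly_single: "eval_poly h \<sigma> (Poly_Mapping.single m c) = h c * eval_monomial \<sigma> m"
  by (simp add: eval_poly_def hom_zero)

lemma eval_poly_sum: "eval_poly h \<sigma> (sum f A) = (\<Sum>x \<in> A. eval_poly h \<sigma> (f x))"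
  by (induction A rule: infinite_finite_induct) (simp_all add: eval_poly_zero eval_poly_add)

text \<open>Bilinearity reduces the claim to products of two single terms, where coefficients
  multiply and exponents add.\<close>

lemma eval_poly_mult: "eval_poly h \<sigma> (p * q) = eval_poly h \<sigma> p * eval_poly h \<sigma> q"
proof -
  let ?t = "\<lambda>p m. Poly_Mapping.single m (Poly_Mapping.lookup p m) :: rpoly"
  have "eval_poly h \<sigma> (p * q) = eval_poly h \<sigma>
      (\<Sum>m \<in> Poly_Mapping.keys p. \<Sum>m' \<in> Poly_Mapping.keys q. ?t p m * ?t q m')"
    by (simp flip: sum_product sum_monomials)
  also have "\<dots> = (\<Sum>m \<in> Poly_Mapping.keys p. \<Sum>m' \<in> Poly_Mapping.keys q.
      (h (Poly_Mapping.lookup p m) * eval_monomial \<sigma> m) *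
      (h (Poly_Mapping.lookup q m') * eval_monomial \<sigma> m'))"
    by (simp add: eval_poly_sum mult_single eval_poly_single hom_mult eval_monomial_add mult_ac)
  finally show ?thesis
    by (simp only: eval_poly_def flip: sum_product)
qed

lemma eval_poly_Const: "eval_poly h \<sigma> (Const c) = h c"
  by (simp add: Const_def eval_poly_single)

lemma eval_poly_one: "eval_poly h \<sigma> 1 = 1"
  by (simp flip: single_one add: eval_poly_single hom_one)

lemma eval_poly_Var: "eval_poly h \<sigma> (Var v) = \<sigma> v"
  by (simp add: Var_def eval_poly_single hom_one eval_monomial_def)

lemma eval_poly_power: "eval_poly h \<sigma> (p ^ n) = eval_poly h \<sigma> p ^ n"
  by (induction n) (simp_all add: eval_poly_one eval_poly_mult)

lemma eval_poly_prod: "eval_poly h \<sigma> (prod f A) = (\<Prod>x \<in> A. eval_poly h \<sigma> (f x))"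
  by (induction A rule: infinite_finite_induct) (simp_all add: eval_poly_one eval_poly_mult)

lemmas eval_poly_simps = eval_poly_zero eval_poly_one eval_poly_add eval_poly_diff eval_poly_mult
  eval_poly_power eval_poly_sum eval_poly_prod eval_poly_Const eval_poly_Var

end

interpretation Const: coeff_hom Const
  by unfold_locales (simp_all add: Const_def single_add mult_single)

interpretation const_poly: coeff_hom "\<lambda>c. [:c:]"
  by unfold_locales (simp_all add: one_pCons)

lemma substitute_eq_eval_poly: "substitute \<sigma> = eval_poly Const \<sigma>"
  by (rule ext) (simp add: substitute_def eval_poly_def eval_monomial_def)

section \<open>Bounds for the total degree\<close>

lemma total_degree_le_iff:
  "total_degree p \<le> n \<longleftrightarrow> (\<forall>m \<in> Poly_Mapping.keys p. monomial_degree m \<le> n)"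
  unfolding total_degree_def by (subst Max_le_iff) auto

lemma monomial_degree_le_total_degree:
  "m \<in> Poly_Mapping.keys p \<Longrightarrow> monomial_degree m \<le> total_degree p"
  using total_degree_le_iff by blast

lemma monomial_degree_add: "monomial_degree (m + m') = monomial_degree m + monomial_degree m'"
proof -
  let ?A = "Poly_Mapping.keys m \<union> Poly_Mapping.keys m'"
  have *: "monomial_degree k = (\<Sum>v \<in> ?A. Poly_Mapping.lookup k v)"
    if "Poly_Mapping.keys k \<subseteq> ?A" for k
    unfolding monomial_degree_def
    by (rule sum.mono_neutral_left) (use that in \<open>auto simp: in_keys_iff\<close>)
  show ?thesis
    by (simp add: * Poly_Mapping.keys_add lookup_add sum.distrib)
qed

lemma total_degree_add_le:
  assumes "total_degree p \<le> n" "total_degree q \<le> n"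
  shows "total_degree (p + q) \<le> n"
  using assms Poly_Mapping.keys_add[of p q] unfolding total_degree_le_iff by blast

lemma total_degree_uminus [simp]: "total_degree (- p) = total_degree p"
  by (simp add: total_degree_def)

lemma total_degree_diff_le:
  assumes "total_degree p \<le> n" "total_degree q \<le> n"
  shows "total_degree (p - q) \<le> n"
  using total_degree_add_le[of p n "- q"] assms by simp

lemma total_degree_mult_le:
  assumes "total_degree p \<le> a" "total_degree q \<le> b"
  shows "total_degree (p * q) \<le> a + b"
  unfolding total_degree_le_iff
proof
  fix m assume "m \<in> Poly_Mapping.keys (p * q)"
  then obtain u v where "m = u + v" "u \<in> Poly_Mapping.keys p" "v \<in> Poly_Mapping.keys q"
    using keys_mult[of p q] by blast
  then show "monomial_degree m \<le> a + b"
    using assms by (auto simp: monomial_degree_add total_degree_le_iff intro!: add_mono)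
qed

lemma total_degree_zero [simp]: "total_degree 0 = 0"
  by (simp add: total_degree_def)

lemma total_degree_Const [simp]: "total_degree (Const c) = 0"
  using total_degree_le_iff[of "Const c" 0] by (simp add: Const_def monomial_degree_def)

lemma total_degree_one [simp]: "total_degree 1 = 0"
  using total_degree_Const[of 1] by (simp add: Const_def)

lemma total_degree_Var [simp]: "total_degree (Var v) = 1"
  by (simp add: total_degree_def Var_def monomial_degree_def)

lemma total_degree_sum_le:
  "(\<And>x. x \<in> A \<Longrightarrow> total_degree (f x) \<le> n) \<Longrightarrow> total_degree (sum f A) \<le> n"
  by (induction A rule: infinite_finite_induct) (auto intro: total_degree_add_le)

lemma total_degree_prod_le:
  "(\<And>x. x \<in> A \<Longrightarrow> total_degree (f x) \<le> 1) \<Longrightarrow> total_degree (prod f A) \<le> card A"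
proof (induction A rule: infinite_finite_induct)
  case (insert x A)
  then have "total_degree (f x * prod f A) \<le> 1 + card A"
    by (intro total_degree_mult_le) auto
  then show ?case using insert by simp
qed auto

lemma total_degree_power2_le: "total_degree p \<le> 1 \<Longrightarrow> total_degree (p\<^sup>2) \<le> 2"
  using total_degree_mult_le[of p 1 p 1] by (simp add: power2_eq_square)

text \<open>Restricting a polynomial to a line through the origin gives a univariate polynomial whose
  degree bounds the total degree from below; the lower bounds for the total degrees below come
  from suitable directions \<open>c\<close>.\<close>

definition along_line :: "(var \<Rightarrow> real) \<Rightarrow> rpoly \<Rightarrow> real poly" where
  "along_line c = eval_poly (\<lambda>x. [:x:]) (\<lambda>v. monom (c v) 1)"

lemma eval_monomial_monom:
  "eval_monomial (\<lambda>v. monom (c v) 1) m = monom (eval_monomial c m) (monomial_degree m)"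
proof -
  have "(\<Prod>v \<in> A. monom (c v) 1 ^ f v) = monom (\<Prod>v \<in> A. c v ^ f v) (\<Sum>v \<in> A. f v)"
    if "finite A" for A and f :: "var \<Rightarrow> nat"
    using that by induction (simp_all add: monom_power mult_monom monom_0 one_pCons)
  then show ?thesis by (simp add: eval_monomial_def monomial_degree_def)
qed

text \<open>On the line, a monomial of degree \<open>k\<close> becomes a multiple of the
  \<open>k\<close>-th power of the parameter. The coefficient at \<open>n\<close> therefore collects
  exactly the monomials of degree \<open>n\<close>, and one of them must occur if it is
  nonzero.\<close>

lemma total_degree_ge_along_line:
  assumes "coeff (along_line c p) n \<noteq> 0"
  shows "n \<le> total_degree p"
proof -
  have "coeff (along_line c p) n = (\<Sum>m \<in> Poly_Mapping.keys p.
      Poly_Mapping.lookup p m * (if monomial_degree m = n then eval_monomial c m else 0))"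
    unfolding along_line_def eval_poly_def eval_monomial_monom by (simp add: coeff_sum)
  with assms obtain m where "m \<in> Poly_Mapping.keys p" "monomial_degree m = n"
    by (smt (verit) mult_eq_0_iff sum.neutral)
  then show ?thesis by (auto dest: monomial_degree_le_total_degree)
qed

lemma total_degree_eqI:
  assumes "total_degree p \<le> n" "coeff (along_line c p) n \<noteq> 0"
  shows "total_degree p = n"
  using assms total_degree_ge_along_line by (metis order_antisym)

section \<open>Degrees of the equations and the Bezout bounds\<close>

lemma finite_springs: "translational_spring_network N \<Longrightarrow> finite (springs N)"
  unfolding translational_spring_network_def
  by (rule finite_subset[of _ "Pow {1..num_nodes N}"]) auto

lemma spring_cases:
  assumes "translational_spring_network N" "s \<in> springs N"
  obtains a b where "s = {a, b}" "a < b" "a \<in> nodes N" "b \<in> nodes N"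
proof -
  have "s \<in> {{a, b} | a b. 1 \<le> a \<and> a < b \<and> b \<le> num_nodes N}"
    using assms by (auto simp: translational_spring_network_def)
  then obtain a b where "s = {a, b}" "1 \<le> a" "a < b" "b \<le> num_nodes N" by blast
  then show thesis using that[of a b] by (simp add: nodes_def)
qed

lemma doubleton_spring:
  assumes "translational_spring_network N" "{a, b} \<in> springs N"
  shows "a \<noteq> b" "a \<in> nodes N" "b \<in> nodes N"
proof -
  obtain c d where "{a, b} = {c, d}" "c < d" "c \<in> nodes N" "d \<in> nodes N"
    using spring_cases[OF assms] .
  then show "a \<noteq> b" "a \<in> nodes N" "b \<in> nodes N"
    by (auto simp: doubleton_eq_iff)
qed

lemma neighbours_subset_nodes: "translational_spring_network N \<Longrightarrow> neighbours N a \<subseteq> nodes N"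
  using doubleton_spring by (auto simp: neighbours_def)

lemma finite_nodes [simp]: "finite (nodes N)"
  by (simp add: nodes_def)

lemma finite_neighbours: "translational_spring_network N \<Longrightarrow> finite (neighbours N a)"
  using neighbours_subset_nodes finite_nodes by (rule finite_subset)

lemma not_neighbour_self: "translational_spring_network N \<Longrightarrow> a \<notin> neighbours N a"
  using doubleton_spring(1)[of N a a] by (auto simp: neighbours_def)

lemma neighbours_sym: "b \<in> neighbours N a \<longleftrightarrow> a \<in> neighbours N b"
  by (simp add: neighbours_def insert_commute)

text \<open>Translates between sums over the springs at a node and sums over its neighbours; it also
  identifies the degree with the number of neighbours.\<close>

lemma bij_betw_neighbours:
  assumes "translational_spring_network N"
  shows "bij_betw (\<lambda>b. {a, b}) (neighbours N a) {s \<in> springs N. a \<in> s}"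
  unfolding bij_betw_def
proof
  show "inj_on (\<lambda>b. {a, b}) (neighbours N a)"
    by (auto simp: inj_on_def doubleton_eq_iff)
  have "s \<in> (\<lambda>b. {a, b}) ` neighbours N a" if s: "s \<in> springs N" "a \<in> s" for s
  proof -
    obtain c d where cd: "s = {c, d}" using spring_cases[OF assms s(1)] .
    then have "s = {a, if a = c then d else c}" using s(2) by auto
    then show ?thesis using s(1) by (auto simp: neighbours_def)
  qed
  then show "(\<lambda>b. {a, b}) ` neighbours N a = {s \<in> springs N. a \<in> s}"
    by (auto simp: neighbours_def)
qed

lemma card_neighbours:
  "translational_spring_network N \<Longrightarrow> card (neighbours N a) = node_degree N a"
  unfolding node_degree_def by (rule bij_betw_same_card[OF bij_betw_neighbours])

lemma neighbours_empty_iff: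
  "translational_spring_network N \<Longrightarrow> neighbours N a = {} \<longleftrightarrow> node_degree N a = 0"
  by (metis card_eq_0_iff card_neighbours finite_neighbours)

section \<open>Total degrees of the equations after fixing base points\<close>

definition base_var :: "nat \<Rightarrow> nat \<Rightarrow> var \<Rightarrow> rpoly" where
  "base_var i j v = (if v \<in> {X i, Y i, Y j} then 0 else Var v)"

lemma fix_base_points_eq: "fix_base_points i j = eval_poly Const (base_var i j)"
  unfolding fix_base_points_def substitute_eq_eval_poly base_var_def ..

lemma total_degree_base_var_le: "total_degree (base_var i j v) \<le> 1"
  by (simp add: base_var_def)

lemma base_var_length [simp]:
  "base_var i j (Len s) = Var (Len s)" "base_var i j (InvLen s) = Var (InvLen s)"
  by (simp_all add: base_var_def)

lemma along_line_base_var: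
  "along_line c (base_var i j v) = (if v \<in> {X i, Y i, Y j} then 0 else monom (c v) 1)"
  unfolding along_line_def base_var_def
  by (simp add: const_poly.eval_poly_zero const_poly.eval_poly_Var)

lemmas along_line_simps = const_poly.eval_poly_simps[of "\<lambda>v. monom (c v) 1" for c, folded along_line_def]

text \<open>In the direction where every (inverse) length is \<open>T\<close>, the coordinate \<open>w\<close> is \<open>- T\<close> and all other
  coordinates vanish, the leading coefficients of the force equations are sums of the positive
  parameters and cannot cancel.\<close>

definition force_direction :: "var \<Rightarrow> var \<Rightarrow> real" where
  "force_direction w v =
     (case v of Len s \<Rightarrow> 1 | InvLen s \<Rightarrow> 1 | _ \<Rightarrow> if v = w then - 1 else 0)"

text \<open>Every summand multiplies all \<open>d\<close> lengths at the node, its own inside the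
  Hooke factor, with a coordinate difference, hence the degree \<open>d + 1\<close>; the leading
  coefficient along \<open>force_direction\<close> is the sum of the spring constants. The condition
  on \<open>Z a\<close> describes exactly the force equations that are kept. At an isolated node the
  sum is empty and the polynomial is 0.\<close>

lemma total_degree_standard_force:
  assumes N: "translational_spring_network N" and Z: "Z = X \<or> Z = Y"
    and a: "Z a \<notin> {X i, Y i, Y j}"
  shows "total_degree (fix_base_points i j (standard_force N Z a)) =
    (if node_degree N a = 0 then 0 else node_degree N a + 1)"
proof (cases "node_degree N a = 0")
  case True
  then have "neighbours N a = {}" using neighbours_empty_iff[OF N] by simp
  then show ?thesis
    using True by (simp add: standard_force_def fix_base_points_eq Const.eval_poly_simps)
next
  case False
  define d where "d = node_degree N a"
  let ?B = "neighbours N a" and ?c = "force_direction (Z a)" and ?\<sigma> = "base_var i j"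
  let ?p = "fix_base_points i j (standard_force N Z a)"
  have p: "?p = (\<Sum>b \<in> ?B. Const (spring_const N {a, b}) *
      (Var (Len {a, b}) - Const (rest_length N {a, b})) *
      (?\<sigma> (Z b) - ?\<sigma> (Z a)) * (\<Prod>m \<in> ?B - {b}. Var (Len {a, m})))"
    by (simp add: standard_force_def fix_base_points_eq Const.eval_poly_simps)
  have fin: "finite ?B" and card: "card ?B = d" and self: "a \<notin> ?B" and ne: "?B \<noteq> {}"
    using finite_neighbours[OF N] card_neighbours[OF N] not_neighbour_self[OF N]
      neighbours_empty_iff[OF N] False by (auto simp: d_def)
  have "total_degree ?p \<le> d + 1"
    unfolding p
  proof (rule total_degree_sum_le)
    fix b assume b: "b \<in> ?B"
    then have "card (?B - {b}) = d - 1" "d > 0" using fin card by (auto simp: card_gt_0_iff)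
    \<comment> \<open>The summands match the factors: spring constant, own length, coordinate
      difference, other lengths.\<close>
    then have eq: "d + 1 = 0 + 1 + 1 + card (?B - {b})" by simp
    show "total_degree (Const (spring_const N {a, b}) *
      (Var (Len {a, b}) - Const (rest_length N {a, b})) *
      (?\<sigma> (Z b) - ?\<sigma> (Z a)) * (\<Prod>m \<in> ?B - {b}. Var (Len {a, m}))) \<le> d + 1"
      unfolding eq
      by (intro total_degree_mult_le total_degree_diff_le total_degree_prod_le total_degree_base_var_le)
         auto
  qed
  moreover have "coeff (along_line ?c ?p) (d + 1) = (\<Sum>b \<in> ?B. spring_const N {a, b})"
  proof -
    have "along_line ?c (Const (spring_const N {a, b}) *
      (Var (Len {a, b}) - Const (rest_length N {a, b})) *
      (?\<sigma> (Z b) - ?\<sigma> (Z a)) * (\<Prod>m \<in> ?B - {b}. Var (Len {a, m}))) =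
      monom (spring_const N {a, b}) (d + 1)
        - monom (spring_const N {a, b} * rest_length N {a, b}) d" if b: "b \<in> ?B" for b
    proof -
      have d: "card (?B - {b}) = d - 1" "d > 0" "b \<noteq> a"
        using fin card b self by (auto simp: card_gt_0_iff)
      \<comment> \<open>The coordinate of a neighbour vanishes in this direction whether it is a
        variable or has been fixed to 0, so both cases are treated alike.\<close>
      have zb: "along_line ?c (?\<sigma> (Z b)) = 0" and za: "along_line ?c (?\<sigma> (Z a)) = monom (- 1) 1"
        using d Z a by (auto simp: along_line_base_var force_direction_def)
      have len: "?c (Len s) = 1" for s by (simp add: force_direction_def)
      have const: "[:x:] = monom x 0" for x :: real by (simp add: monom_0)
      show ?thesis
        unfolding along_line_simps zb za len const
        using d by (simp add: mult_monom monom_power ring_distribs minus_monom)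
    qed
    then show ?thesis
      unfolding p along_line_simps coeff_sum by (intro sum.cong) auto
  qed
  moreover have "(\<Sum>b \<in> ?B. spring_const N {a, b}) > 0"
    using N fin ne by (intro sum_pos) (auto simp: translational_spring_network_def neighbours_def)
  ultimately show ?thesis
    using total_degree_eqI[of ?p "d + 1" ?c] False by (simp add: d_def)
qed

text \<open>No product of lengths appears here, so the degree is 2 for any positive number of
  neighbours. The quadratic coefficients along \<open>force_direction\<close> are all negative and
  cannot cancel.\<close>

lemma total_degree_inverse_length_force:
  assumes N: "translational_spring_network N" and Z: "Z = X \<or> Z = Y"
    and a: "Z a \<notin> {X i, Y i, Y j}"
  shows "total_degree (fix_base_points i j (inverse_length_force N Z a)) =
    (if node_degree N a = 0 then 0 else 2)"
proof (cases "node_degree N a = 0")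
  case True
  then have "neighbours N a = {}" using neighbours_empty_iff[OF N] by simp
  then show ?thesis
    using True by (simp add: inverse_length_force_def fix_base_points_eq Const.eval_poly_simps)
next
  case False
  let ?B = "neighbours N a" and ?c = "force_direction (Z a)" and ?\<sigma> = "base_var i j"
  let ?p = "fix_base_points i j (inverse_length_force N Z a)"
  let ?t = "\<lambda>b. Const (spring_const N {a, b}) *
      (1 - Const (rest_length N {a, b}) * Var (InvLen {a, b})) * (?\<sigma> (Z b) - ?\<sigma> (Z a))"
  have p: "?p = (\<Sum>b \<in> ?B. ?t b)"
    by (simp add: inverse_length_force_def fix_base_points_eq Const.eval_poly_simps)
  have fin: "finite ?B" and self: "a \<notin> ?B" and ne: "?B \<noteq> {}"
    using finite_neighbours[OF N] not_neighbour_self[OF N]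
      neighbours_empty_iff[OF N] False by auto
  have "total_degree (?t b) \<le> 0 + (0 + 1) + 1" for b
    by (intro total_degree_mult_le total_degree_diff_le total_degree_base_var_le) auto
  then have "total_degree ?p \<le> 2"
    unfolding p by (intro total_degree_sum_le) (simp add: numeral_2_eq_2)
  moreover have "coeff (along_line ?c ?p) 2 =
      (\<Sum>b \<in> ?B. - (spring_const N {a, b} * rest_length N {a, b}))"
  proof -
    have "along_line ?c (?t b) = monom (spring_const N {a, b}) 1
        - monom (spring_const N {a, b} * rest_length N {a, b}) 2" if b: "b \<in> ?B" for b
    proof -
      have "b \<noteq> a" using b self by auto
      then have zb: "along_line ?c (?\<sigma> (Z b)) = 0"
        and za: "along_line ?c (?\<sigma> (Z a)) = monom (- 1) 1"
        using Z a by (auto simp: along_line_base_var force_direction_def)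
      have len: "?c (InvLen s) = 1" for s by (simp add: force_direction_def)
      have const: "[:x:] = monom x 0" for x :: real by (simp add: monom_0)
      have one: "(1 :: real poly) = monom 1 0" by (simp add: monom_0 one_pCons)
      show ?thesis
        unfolding along_line_simps zb za len const one
        by (simp add: mult_monom ring_distribs minus_monom numeral_2_eq_2)
    qed
    then show ?thesis
      unfolding p along_line_simps coeff_sum by (intro sum.cong) auto
  qed
  moreover have "(\<Sum>b \<in> ?B. spring_const N {a, b} * rest_length N {a, b}) > 0"
    using N fin ne by (intro sum_pos) (auto simp: translational_spring_network_def neighbours_def)
  ultimately show ?thesis
    using total_degree_eqI[of ?p 2 ?c] False by (simp add: sum_negf)
qed

lemma total_degree_squared_distance_le:
  "total_degree (fix_base_points i j (squared_distance s)) \<le> 2"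
  unfolding squared_distance_def fix_base_points_eq Const.eval_poly_simps
  by (intro total_degree_add_le total_degree_power2_le total_degree_diff_le
      total_degree_base_var_le)

text \<open>The length variable is never fixed and does not occur in the squared distance, so moving
  it alone exposes the term of degree 2.\<close>

lemma total_degree_standard_geometric:
  "total_degree (fix_base_points i j (standard_system N (Geometric s))) = 2"
proof (rule total_degree_eqI[where c = "\<lambda>v. if v = Len s then 1 else 0"])
  have eq: "fix_base_points i j (standard_system N (Geometric s)) =
      fix_base_points i j (squared_distance s) - (Var (Len s))\<^sup>2"
    by (simp only: standard_system.simps fix_base_points_eq Const.eval_poly_simps base_var_length)
  show "total_degree (fix_base_points i j (standard_system N (Geometric s))) \<le> 2"
    unfolding eq by (intro total_degree_diff_le total_degree_squared_distance_le total_degree_power2_le) simp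
  show "coeff (along_line (\<lambda>v. if v = Len s then 1 else 0)
      (fix_base_points i j (standard_system N (Geometric s)))) 2 \<noteq> 0"
    unfolding eq
    unfolding squared_distance_def fix_base_points_eq Const.eval_poly_simps
    unfolding along_line_simps along_line_base_var
    by (simp add: monom_power)
qed

lemma total_degree_inverse_length_geometric:
  assumes N: "translational_spring_network N" and s: "s \<in> springs N"
  shows "total_degree (fix_base_points i j (inverse_length_system N (Geometric s))) = 4"
proof -
  obtain a b where ab: "s = {a, b}" "a < b" using spring_cases[OF N s] by metis
  then have mm: "Min s = a" "Max s = b" by (auto simp: max_def min_def)
  \<comment> \<open>Among the x-coordinates only that of \<open>i\<close> is fixed, so each spring
    has an endpoint \<open>e\<close> with a free one; moving it together with the inverse length
    gives the fourth power.\<close>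
  define e where "e = (if a = i then b else a)"
  have e: "e = a \<or> e = b" "e \<noteq> i" using ab(2) by (auto simp: e_def)
  let ?c = "\<lambda>v. if v = X e \<or> v = InvLen s then 1 else 0"
  show ?thesis
  proof (rule total_degree_eqI[where c = ?c])
    have eq: "fix_base_points i j (inverse_length_system N (Geometric s)) =
        fix_base_points i j (squared_distance s) * (Var (InvLen s))\<^sup>2 - 1"
      by (simp only: inverse_length_system.simps fix_base_points_eq Const.eval_poly_simps
          base_var_length)
    have "total_degree (fix_base_points i j (squared_distance s) * (Var (InvLen s))\<^sup>2) \<le> 2 + 2"
      by (intro total_degree_mult_le total_degree_squared_distance_le total_degree_power2_le) simp
    then show "total_degree (fix_base_points i j (inverse_length_system N (Geometric s))) \<le> 4"
      unfolding eq by (intro total_degree_diff_le) simp_all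
    show "coeff (along_line ?c
        (fix_base_points i j (inverse_length_system N (Geometric s)))) 4 \<noteq> 0"
      unfolding eq
      unfolding squared_distance_def fix_base_points_eq Const.eval_poly_simps mm
      unfolding along_line_simps along_line_base_var
      using e ab(2) by (elim disjE) (simp_all add: monom_power mult_monom)
  qed
qed

section \<open>Product formulas for the Bezout bounds and their comparison\<close>

lemma bezout_bound_split:
  assumes N: "translational_spring_network N"
    and ij: "i \<in> nodes N" "j \<in> nodes N" "i \<noteq> j"
    and geo: "\<And>s. s \<in> springs N \<Longrightarrow> total_degree (F (Geometric s)) = g"
    and fx: "\<And>a. a \<noteq> i \<Longrightarrow> total_degree (F (ForceX a)) = D a"
    and fy: "\<And>a. a \<noteq> i \<Longrightarrow> a \<noteq> j \<Longrightarrow> total_degree (F (ForceY a)) = D a"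
  shows "bezout_bound (based_equations N i j) F =
    g ^ card (springs N) * prod D (nodes N - {i}) * prod D (nodes N - {i, j})"
proof -
  let ?d = "\<lambda>e. total_degree (F e)"
  define A where "A = Geometric ` springs N"
  define B where "B = ForceX ` (nodes N - {i})"
  define C where "C = ForceY ` (nodes N - {i, j})"
  have fin: "finite A" "finite B" "finite C"
    using finite_springs[OF N] by (simp_all add: A_def B_def C_def)
  have dis: "A \<inter> (B \<union> C) = {}" "B \<inter> C = {}"
    by (auto simp: A_def B_def C_def)
  \<comment> \<open>The x-direction equation at \<open>j\<close> survives while its y-direction
    equation does not, which is why one product omits only \<open>i\<close> and the other omits both
    base points.\<close>
  have "based_equations N i j = A \<union> (B \<union> C)"
    by (auto simp: based_equations_def equations_def A_def B_def C_def)
  then have "bezout_bound (based_equations N i j) F = prod ?d A * (prod ?d B * prod ?d C)"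
    unfolding bezout_bound_def using fin dis by (simp add: prod.union_disjoint)
  moreover have "prod ?d A = g ^ card (springs N)"
    unfolding A_def using geo by (subst prod.reindex) (auto simp: inj_on_def)
  moreover have "prod ?d B = prod D (nodes N - {i})"
    unfolding B_def using fx by (subst prod.reindex) (auto simp: inj_on_def)
  moreover have "prod ?d C = prod D (nodes N - {i, j})"
    unfolding C_def using fy by (subst prod.reindex) (auto simp: inj_on_def)
  ultimately show ?thesis by simp
qed

text \<open>The case split reflects that an isolated node has zero force polynomials, of degree 0 by
  convention; the value stays monotone in the node degree.\<close>

definition std_force_degree :: "spring_network \<Rightarrow> nat \<Rightarrow> nat" where
  "std_force_degree N a = (if node_degree N a = 0 then 0 else node_degree N a + 1)"

lemma B_standard_eq:
  assumes "translational_spring_network N" "(i, j) \<in> base_pairs N"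
  shows "B_standard N i j = 2 ^ card (springs N) *
    prod (std_force_degree N) (nodes N - {i}) * prod (std_force_degree N) (nodes N - {i, j})"
  unfolding B_standard_def using assms
  by (intro bezout_bound_split)
     (simp_all del: standard_system.simps(1) add: base_pairs_def total_degree_standard_geometric total_degree_standard_force
        std_force_degree_def)

text \<open>Every kept force equation contributes the same factor 2, and the number of kept
  equations is the same for all base pairs.\<close>

lemma B_inverse_eq:
  assumes "translational_spring_network N" "(i, j) \<in> base_pairs N"
    "\<And>a. a \<in> nodes N \<Longrightarrow> node_degree N a \<noteq> 0"
  shows "B_inverse N i j = 4 ^ card (springs N) * 2 ^ (card (nodes N) - 1) * 2 ^ (card (nodes N) - 2)"
proof -
  have "B_inverse N i j = 4 ^ card (springs N) *
    (\<Prod>a \<in> nodes N - {i}. if node_degree N a = 0 then 0 else 2) *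
    (\<Prod>a \<in> nodes N - {i, j}. if node_degree N a = 0 then 0 else 2)"
    unfolding B_inverse_def using assms(1,2)
    by (intro bezout_bound_split)
       (simp_all del: inverse_length_system.simps(1) add: base_pairs_def total_degree_inverse_length_geometric
          total_degree_inverse_length_force)
  also have "\<dots> = 4 ^ card (springs N) * (\<Prod>a \<in> nodes N - {i}. 2) * (\<Prod>a \<in> nodes N - {i, j}. 2)"
    using assms(3) by (intro arg_cong2[where f = "(*)"] prod.cong refl) auto
  also have "\<dots> = 4 ^ card (springs N) * 2 ^ (card (nodes N) - 1) * 2 ^ (card (nodes N) - 2)"
    using assms(2) by (simp add: base_pairs_def card_Diff_subset)
  finally show ?thesis .
qed

text \<open>Exchange argument: the factors outside \<open>A \<union> A'\<close> are common to both
  sides, and the remaining index sets \<open>A' - A\<close> and \<open>A - A'\<close> have equal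
  size, so a bijection compares them factor by factor.\<close>

lemma prod_Diff_le:
  fixes D :: "'a \<Rightarrow> nat"
  assumes "finite V" "A \<subseteq> V" "A' \<subseteq> V" "card A = card A'"
    and le: "\<And>x y. x \<in> A' - A \<Longrightarrow> y \<in> A - A' \<Longrightarrow> D x \<le> D y"
  shows "prod D (V - A) \<le> prod D (V - A')"
proof -
  have fin: "finite A" "finite A'" using assms finite_subset by blast+
  then have "card (A' - A) = card (A - A')"
    using assms(4) by (simp add: card_Diff_subset_Int Int_commute)
  then obtain f where f: "bij_betw f (A' - A) (A - A')"
    using fin by (meson finite_Diff finite_same_card_bij)
  have "prod D (A' - A) \<le> prod (D \<circ> f) (A' - A)"
    using f le by (intro prod_mono) (auto simp: bij_betw_def)
  also have "\<dots> = prod D (A - A')"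
    using f by (simp add: prod.reindex_bij_betw comp_def)
  finally have *: "prod D (A' - A) \<le> prod D (A - A')" .
  have split: "prod D (V - B) = prod D (V - (A \<union> A')) * prod D C"
    if "V - B = (V - (A \<union> A')) \<union> C" "C \<subseteq> A \<union> A'" for B C
  proof -
    have "finite C" using that(2) fin by (auto intro: finite_subset)
    then show ?thesis
      unfolding that(1) using \<open>finite V\<close> that(2) by (intro prod.union_disjoint) auto
  qed
  have "prod D (V - A) = prod D (V - (A \<union> A')) * prod D (A' - A)"
    "prod D (V - A') = prod D (V - (A \<union> A')) * prod D (A - A')"
    using assms(2,3) by (intro split; blast)+
  then show ?thesis using * by simp
qed

text \<open>The exchange argument is applied to the omitted sets \<open>{i}\<close> and
  \<open>{i, j}\<close>. In the second case, a node of \<open>{i', j'}\<close> outside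
  \<open>{i, j}\<close> differs from \<open>i\<close>, so its degree is at most that of
  \<open>i\<close> and at most that of \<open>j\<close>.\<close>

lemma B_standard_minimal:
  assumes N: "translational_spring_network N"
    and ij: "(i, j) \<in> base_pairs N" and ij': "(i', j') \<in> base_pairs N"
    and max_i: "\<And>a. a \<in> nodes N \<Longrightarrow> node_degree N a \<le> node_degree N i"
    and max_j: "\<And>a. a \<in> nodes N - {i} \<Longrightarrow> node_degree N a \<le> node_degree N j"
  shows "B_standard N i j \<le> B_standard N i' j'"
proof -
  let ?D = "std_force_degree N"
  have mono: "node_degree N a \<le> node_degree N b \<Longrightarrow> ?D a \<le> ?D b" for a b
    by (simp add: std_force_degree_def)
  have "prod ?D (nodes N - {i}) \<le> prod ?D (nodes N - {i'})"
    using ij ij' max_i by (intro prod_Diff_le mono) (auto simp: base_pairs_def)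
  moreover have "prod ?D (nodes N - {i, j}) \<le> prod ?D (nodes N - {i', j'})"
    using ij ij' max_i max_j by (intro prod_Diff_le mono) (auto simp: base_pairs_def)
  ultimately show ?thesis
    unfolding B_standard_eq[OF N ij] B_standard_eq[OF N ij'] by (intro mult_mono) auto
qed

section \<open>Rigid networks have no isolated nodes\<close>

definition spring_energy :: "spring_network \<Rightarrow> (nat \<Rightarrow> real^2) \<Rightarrow> nat set \<Rightarrow> real" where
  "spring_energy N p s =
     spring_const N s * (dist (p (Min s)) (p (Max s)) - rest_length N s)\<^sup>2"

text \<open>This is twice the physical elastic energy, the factor 1/2 of Hooke's law being
  dropped.\<close>

definition energy :: "spring_network \<Rightarrow> (nat \<Rightarrow> real^2) \<Rightarrow> real" where
  "energy N p = (\<Sum>s \<in> springs N. spring_energy N p s)"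

lemma spring_energy_doubleton:
  "spring_energy N p {a, b} =
     spring_const N {a, b} * (dist (p a) (p b) - rest_length N {a, b})\<^sup>2"
  by (cases "a \<le> b") (simp_all add: spring_energy_def dist_commute max_def min_def)

text \<open>Isolates the part of the energy that changes when only the node \<open>a\<close>
  moves.\<close>

lemma energy_at_node:
  assumes N: "translational_spring_network N"
  shows "energy N p = (\<Sum>s \<in> {s \<in> springs N. a \<notin> s}. spring_energy N p s) +
    (\<Sum>b \<in> neighbours N a. spring_energy N p {a, b})"
proof -
  have "(\<Sum>b \<in> neighbours N a. spring_energy N p {a, b}) =
      (\<Sum>s \<in> {s \<in> springs N. a \<in> s}. spring_energy N p s)"
    by (rule sum.reindex_bij_betw[OF bij_betw_neighbours[OF N]])
  moreover have "energy N p = (\<Sum>s \<in> springs N \<inter> {s. a \<in> s}. spring_energy N p s) +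
      (\<Sum>s \<in> springs N - {s. a \<in> s}. spring_energy N p s)"
    unfolding energy_def using finite_springs[OF N] by (rule sum.Int_Diff)
  moreover have "springs N \<inter> {s. a \<in> s} = {s \<in> springs N. a \<in> s}"
    "springs N - {s. a \<in> s} = {s \<in> springs N. a \<notin> s}" by auto
  ultimately show ?thesis by simp
qed

lemma spring_params_pos:
  assumes "translational_spring_network N" "b \<in> neighbours N a"
  shows "spring_const N {a, b} > 0" "rest_length N {a, b} > 0"
  using assms by (auto simp: translational_spring_network_def neighbours_def)

text \<open>The vectors \<open>w b\<close> are subgradients of the norm at \<open>p a - p b\<close>; where the two points
  coincide, every vector of the unit ball is allowed.\<close>

lemma energy_minimiser_balance:
  fixes p :: "nat \<Rightarrow> real^2"
  assumes N: "translational_spring_network N"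
    and min: "\<And>q. energy N p \<le> energy N q"
    and w: "\<And>b. b \<in> neighbours N a \<Longrightarrow> norm (w b) \<le> 1 \<and> w b \<bullet> (p a - p b) = norm (p a - p b)"
  shows "(\<Sum>b \<in> neighbours N a.
    spring_const N {a, b} *\<^sub>R (p a - p b - rest_length N {a, b} *\<^sub>R w b)) = 0" (is "?F = 0")
proof (cases "neighbours N a = {}")
  case False
  let ?k = "\<lambda>b. spring_const N {a, b}" and ?r = "\<lambda>b. rest_length N {a, b}"
  define K where "K = (\<Sum>b \<in> neighbours N a. ?k b)"
  define F where "F = ?F"
  \<comment> \<open>This displacement minimises the upper bound
    \<open>2 * (F \<bullet> u) + K * (norm u)\<^sup>2\<close> for the change of energy; the minimum
    is negative unless \<open>F = 0\<close>.\<close>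
  define u where "u = - (1 / K) *\<^sub>R F"
  have "K > 0"
    unfolding K_def using False N
    by (intro sum_pos finite_neighbours) (auto intro: spring_params_pos)
  let ?q = "p(a := p a + u)"
  have change: "spring_energy N ?q {a, b} - spring_energy N p {a, b} \<le>
      2 * ((?k b *\<^sub>R (p a - p b - ?r b *\<^sub>R w b)) \<bullet> u) + ?k b * (norm u)\<^sup>2"
    if b: "b \<in> neighbours N a" for b
  proof -
    let ?v = "p a - p b"
    have "b \<noteq> a" using b not_neighbour_self[OF N] by auto
    then have 1: "spring_energy N ?q {a, b} - spring_energy N p {a, b} =
        ?k b * ((norm (?v + u) - ?r b)\<^sup>2 - (norm ?v - ?r b)\<^sup>2)"
      by (simp add: spring_energy_doubleton dist_norm algebra_simps)
    have "(norm (?v + u) - ?r b)\<^sup>2 - (norm ?v - ?r b)\<^sup>2 =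
        2 * (?v \<bullet> u) + (norm u)\<^sup>2 - 2 * ?r b * (norm (?v + u) - norm ?v)"
    proof -
      have "(norm (?v + u))\<^sup>2 = (norm ?v)\<^sup>2 + 2 * (?v \<bullet> u) + (norm u)\<^sup>2"
        by (simp add: power2_norm_eq_inner inner_add_left inner_add_right inner_commute)
      then show ?thesis by (simp add: power2_diff right_diff_distrib)
    qed
    \<comment> \<open>The norm difference enters with a negative factor, so the subgradient
      inequality, a lower bound for it, bounds the energy change from above.\<close>
    also have "\<dots> \<le> 2 * (?v \<bullet> u) + (norm u)\<^sup>2 - 2 * ?r b * (w b \<bullet> u)"
    proof -
      have "w b \<bullet> (?v + u) \<le> norm (w b) * norm (?v + u)" by (rule norm_cauchy_schwarz)
      also have "\<dots> \<le> norm (?v + u)" using w[OF b] by (simp add: mult_left_le_one_le)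
      finally have "w b \<bullet> u \<le> norm (?v + u) - norm ?v"
        using w[OF b] by (simp add: inner_add_right)
      then show ?thesis
        using spring_params_pos[OF N b] by (simp add: mult_left_mono)
    qed
    finally have "?k b * ((norm (?v + u) - ?r b)\<^sup>2 - (norm ?v - ?r b)\<^sup>2) \<le>
        ?k b * (2 * (?v \<bullet> u) + (norm u)\<^sup>2 - 2 * ?r b * (w b \<bullet> u))"
      using spring_params_pos[OF N b] by (simp add: mult_left_mono)
    also have "\<dots> = 2 * ((?k b *\<^sub>R (?v - ?r b *\<^sub>R w b)) \<bullet> u) + ?k b * (norm u)\<^sup>2"
      by (simp add: inner_diff_left algebra_simps)
    finally show ?thesis unfolding 1 .
  qed
  have "0 \<le> energy N ?q - energy N p" using min by simp
  also have "\<dots> = (\<Sum>b \<in> neighbours N a. spring_energy N ?q {a, b} - spring_energy N p {a, b})"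
  proof -
    have "spring_energy N ?q s = spring_energy N p s" if s: "s \<in> springs N" "a \<notin> s" for s
    proof -
      obtain c d where "s = {c, d}" using spring_cases[OF N s(1)] .
      then show ?thesis using s(2) by (simp add: spring_energy_doubleton)
    qed
    then have "(\<Sum>s \<in> {s \<in> springs N. a \<notin> s}. spring_energy N ?q s) =
        (\<Sum>s \<in> {s \<in> springs N. a \<notin> s}. spring_energy N p s)"
      by (intro sum.cong) auto
    then show ?thesis
      unfolding energy_at_node[OF N, of _ a] by (simp add: sum_subtractf)
  qed
  also have "\<dots> \<le> (\<Sum>b \<in> neighbours N a.
      2 * ((?k b *\<^sub>R (p a - p b - ?r b *\<^sub>R w b)) \<bullet> u) + ?k b * (norm u)\<^sup>2)"
    by (intro sum_mono change)
  also have "\<dots> = 2 * (F \<bullet> u) + K * (norm u)\<^sup>2"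
    by (simp add: F_def sum.distrib K_def inner_sum_left sum_distrib_left sum_distrib_right
        mult.assoc)
  also have "\<dots> = - ((norm F)\<^sup>2 / K)"
    using \<open>K > 0\<close> by (simp add: u_def dot_square_norm field_simps power2_eq_square)
  finally have "(norm F)\<^sup>2 \<le> 0"
    using \<open>K > 0\<close> by (simp add: field_simps)
  then show ?thesis by (simp add: F_def)
qed simp

text \<open>If \<open>a\<close> coincided with a neighbour \<open>b\<close>, the balance would hold
  for two different subgradients at \<open>b\<close>; subtracting leaves a positive multiple of a
  unit vector equal to 0. So adjacent nodes are distinct, and the balance says that the Hooke forces
  cancel.\<close>

lemma energy_minimiser_equilibrium:
  assumes N: "translational_spring_network N"
    and min: "\<And>q. energy N p \<le> energy N q"
  shows "equilibrium N p"
  unfolding equilibrium_def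
proof (intro ballI conjI)
  fix a
  let ?k = "\<lambda>b. spring_const N {a, b}" and ?r = "\<lambda>b. rest_length N {a, b}"
  \<comment> \<open>For coinciding points division by zero yields \<open>w b = 0\<close>, which
    still lies in the unit ball.\<close>
  define w where "w = (\<lambda>b. (1 / norm (p a - p b)) *\<^sub>R (p a - p b))"
  have w: "norm (w b) \<le> 1 \<and> w b \<bullet> (p a - p b) = norm (p a - p b)" for b
    by (simp add: w_def power2_norm_eq_inner[symmetric] power2_eq_square)
  have sum_w: "(\<Sum>b \<in> neighbours N a. ?k b *\<^sub>R (p a - p b - ?r b *\<^sub>R w b)) = 0"
    using energy_minimiser_balance[OF N min, of a w] w by blast
  show ne: "p a \<noteq> p b" if b: "b \<in> neighbours N a" for b
  proof
    assume eq: "p a = p b"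
    define w' where "w' = w(b := axis 1 1)"
    have "norm (w' c) \<le> 1 \<and> w' c \<bullet> (p a - p c) = norm (p a - p c)" for c
      using w[of c] eq by (simp add: w'_def)
    then have "(\<Sum>c \<in> neighbours N a. ?k c *\<^sub>R (p a - p c - ?r c *\<^sub>R w' c)) = 0"
      using energy_minimiser_balance[OF N min, of a w'] by blast
    then have "(\<Sum>c \<in> neighbours N a. ?k c *\<^sub>R (p a - p c - ?r c *\<^sub>R w c) -
        ?k c *\<^sub>R (p a - p c - ?r c *\<^sub>R w' c)) = 0"
      using sum_w by (simp add: sum_subtractf)
    also have "(\<Sum>c \<in> neighbours N a. ?k c *\<^sub>R (p a - p c - ?r c *\<^sub>R w c) -
        ?k c *\<^sub>R (p a - p c - ?r c *\<^sub>R w' c)) =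
        (\<Sum>c \<in> neighbours N a. if c = b then (?k b * ?r b) *\<^sub>R axis 1 1 else 0)"
      by (intro sum.cong) (auto simp: w'_def eq w_def)
    also have "\<dots> = (?k b * ?r b) *\<^sub>R axis 1 1"
      using b finite_neighbours[OF N] by simp
    finally show False
      using spring_params_pos[OF N b] by (simp add: axis_eq_0_iff)
  qed
  have "hooke_force N p a b = - (?k b *\<^sub>R (p a - p b - ?r b *\<^sub>R w b))"
    if b: "b \<in> neighbours N a" for b
  proof -
    have "dist (p a) (p b) \<noteq> 0" using ne[OF b] by simp
    then have "hooke_force N p a b = (?k b - ?k b * ?r b / dist (p a) (p b)) *\<^sub>R (p b - p a)"
      by (simp add: hooke_force_def field_simps)
    also have "\<dots> = - (?k b *\<^sub>R (p a - p b - ?r b *\<^sub>R w b))"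
      by (simp add: w_def dist_norm algebra_simps)
    finally show ?thesis .
  qed
  then show "(\<Sum>b \<in> neighbours N a. hooke_force N p a b) = 0"
    using sum_w by (simp add: sum_negf)
qed

lemma spring_energy_nonneg:
  "translational_spring_network N \<Longrightarrow> s \<in> springs N \<Longrightarrow> 0 \<le> spring_energy N p s"
  by (auto simp: translational_spring_network_def spring_energy_def less_imp_le)

text \<open>The energy bounds the length of each spring, and the triangle inequality adds these
  bounds along a path. The bound \<open>M\<close> is uniform in \<open>p\<close>, as compactness
  requires.\<close>

lemma dist_bounded_by_energy:
  assumes N: "translational_spring_network N"
    and ab: "(a, b) \<in> {(a, b). {a, b} \<in> springs N}\<^sup>*"
  shows "\<exists>M. \<forall>p. energy N p \<le> E \<longrightarrow> dist (p a) (p b) \<le> M"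
  using ab
proof induction
  case base
  show ?case by (intro exI[of _ 0]) simp
next
  case (step b c)
  then obtain M where M: "\<And>p. energy N p \<le> E \<Longrightarrow> dist (p a) (p b) \<le> M" by blast
  have s: "{b, c} \<in> springs N" using step by simp
  define k r where "k = spring_const N {b, c}" and "r = rest_length N {b, c}"
  have "k > 0" using s N by (simp add: translational_spring_network_def k_def)
  have "dist (p a) (p c) \<le> M + (r + sqrt (E / k))" if p: "energy N p \<le> E" for p
  proof -
    have "spring_energy N p {b, c} \<le> energy N p"
      unfolding energy_def
      by (intro member_le_sum s spring_energy_nonneg[OF N] finite_springs[OF N]) auto
    then have "k * (dist (p b) (p c) - r)\<^sup>2 \<le> E"
      using p by (simp add: spring_energy_doubleton k_def r_def)
    then have "(dist (p b) (p c) - r)\<^sup>2 \<le> E / k"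
      using \<open>k > 0\<close> by (simp add: field_simps)
    then have "dist (p b) (p c) - r \<le> sqrt (E / k)"
      by (rule real_le_rsqrt)
    moreover have "dist (p a) (p c) \<le> dist (p a) (p b) + dist (p b) (p c)"
      by (rule dist_triangle)
    ultimately show ?thesis using M[OF p] by simp
  qed
  then show ?case by blast
qed

text \<open>Moving the least node of every connected component to the origin does not change the
  energy, so it suffices to minimise over a compact product of balls.\<close>

lemma energy_minimiser_exists:
  assumes N: "translational_spring_network N"
  shows "\<exists>p. \<forall>q. energy N p \<le> energy N q"
proof -
  define G where "G = {(a, b). {a, b} \<in> springs N}"
  \<comment> \<open>An index that is not a node has no springs and is its own root, so the shifted
    configuration is 0 there.\<close>
  define root where "root = (\<lambda>a. LEAST c. (a, c) \<in> G\<^sup>*)"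
  \<comment> \<open>The collapsed configuration supplies a reference level: only configurations of
    energy at most \<open>E\<close> compete for the minimum.\<close>
  define E where "E = energy N (\<lambda>_. 0)"
  have "(a, root a) \<in> G\<^sup>*" for a
    unfolding root_def by (rule LeastI[of _ a]) simp
  then have "\<exists>M. \<forall>p. energy N p \<le> E \<longrightarrow> dist (p a) (p (root a)) \<le> M" for a
    unfolding G_def by (intro dist_bounded_by_energy N)
  then obtain M where M: "\<And>a p. energy N p \<le> E \<Longrightarrow> dist (p a) (p (root a)) \<le> M a"
    by metis
  have root_eq: "root a = root b" if "{a, b} \<in> springs N" for a b
  proof -
    have "(a, b) \<in> G\<^sup>*" "(b, a) \<in> G\<^sup>*"
      using that by (auto simp: G_def insert_commute)
    then have "(a, c) \<in> G\<^sup>* \<longleftrightarrow> (b, c) \<in> G\<^sup>*" for c by (meson rtrancl_trans)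
    then show ?thesis by (simp add: root_def)
  qed
  define K where "K = (PiE UNIV (\<lambda>a. cball 0 (M a)) :: (nat \<Rightarrow> real^2) set)"
  have shift: "\<exists>q \<in> K. energy N q = energy N p" if "energy N p \<le> E" for p
  proof
    let ?q = "\<lambda>a. p a - p (root a)"
    show "?q \<in> K" using M[OF that] by (auto simp: K_def dist_norm norm_minus_commute)
    have "spring_energy N ?q s = spring_energy N p s" if s: "s \<in> springs N" for s
    proof -
      obtain c d where cd: "s = {c, d}" using spring_cases[OF N s] .
      then have "root c = root d" using root_eq s by simp
      then show ?thesis unfolding cd spring_energy_doubleton by (simp add: dist_norm)
    qed
    then show "energy N ?q = energy N p" by (simp add: energy_def)
  qed
  have "\<exists>q \<in> K. energy N q = E"
    unfolding E_def by (rule shift) (simp add: E_def)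
  then obtain q0 where "q0 \<in> K" "energy N q0 = E" by blast
  \<comment> \<open>Tychonoff's theorem; the energy involves finitely many coordinates and is
    therefore continuous in the product topology.\<close>
  have "compactin (product_topology (\<lambda>_. euclidean) UNIV) K"
    unfolding K_def by (subst compactin_PiE) auto
  then have "compact K" by (simp add: euclidean_product_topology)
  moreover have "K \<noteq> {}" using \<open>q0 \<in> K\<close> by blast
  moreover have "continuous_on K (energy N)"
  proof -
    have "continuous_on K (\<lambda>p. p a)" for a :: nat
      by (rule continuous_on_subset[OF continuous_on_product_coordinates]) simp
    then show ?thesis
      unfolding energy_def[abs_def] spring_energy_def by (intro continuous_intros)
  qed
  ultimately obtain p where p: "p \<in> K" "\<And>q. q \<in> K \<Longrightarrow> energy N p \<le> energy N q"
    using continuous_attains_inf[of K "energy N"] by blast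
  have "energy N p \<le> E" using p(2)[OF \<open>q0 \<in> K\<close>] \<open>energy N q0 = E\<close> by simp
  have "energy N p \<le> energy N q" for q
  proof (cases "energy N q \<le> E")
    case True
    then obtain q' where "q' \<in> K" "energy N q' = energy N q" using shift by blast
    then show ?thesis using p(2)[of q'] by simp
  next
    case False
    then show ?thesis using \<open>energy N p \<le> E\<close> by simp
  qed
  then show ?thesis by blast
qed

lemma equilibrium_cong:
  assumes N: "translational_spring_network N" and "\<And>a. a \<in> nodes N \<Longrightarrow> p a = q a"
  shows "equilibrium N p \<longleftrightarrow> equilibrium N q"
proof -
  have "p b = q b" if "b \<in> neighbours N a" for a b
    using that assms neighbours_subset_nodes[OF N] by blast
  then show ?thesis
    using assms(2) by (simp add: equilibrium_def hooke_force_def cong: sum.cong)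
qed

lemma equilibria_nonempty:
  assumes N: "translational_spring_network N"
  shows "equilibria N \<noteq> {}"
proof -
  obtain p where "\<And>q. energy N p \<le> energy N q" using energy_minimiser_exists[OF N] by blast
  then have "equilibrium N p" by (rule energy_minimiser_equilibrium[OF N])
  \<comment> \<open>The minimiser is a function on all of \<open>nat\<close>, whereas embeddings are
    extensional on the nodes.\<close>
  then have "equilibrium N (restrict p (nodes N))"
    using equilibrium_cong[OF N, of "restrict p (nodes N)" p] by simp
  then have "restrict p (nodes N) \<in> equilibria N"
    by (simp add: equilibria_def embeddings_def)
  then show ?thesis by blast
qed

section \<open>Equilibria up to rotations and translations\<close>

lemma rotation_matrix_norm:
  "rotation_matrix R \<Longrightarrow> norm (R *v x) = norm (x :: real^'n)"
  by (rule orthogonal_transformation_norm)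
     (simp add: rotation_matrix_def orthogonal_transformation_matrix)

lemma rotation_matrix_id: "rotation_matrix (mat 1 :: real^'n^'n)"
  by (simp add: rotation_matrix_def orthogonal_matrix_id)

lemma rotation_matrix_transpose: "rotation_matrix R \<Longrightarrow> rotation_matrix (transpose (R :: real^'n^'n))"
  by (simp add: rotation_matrix_def)

lemma rotation_matrix_mul:
  "rotation_matrix A \<Longrightarrow> rotation_matrix B \<Longrightarrow> rotation_matrix (A ** (B :: real^'n^'n))"
  by (simp add: rotation_matrix_def orthogonal_matrix_mul det_mul)

lemma rotation_matrix_transpose_mult:
  "rotation_matrix R \<Longrightarrow> transpose R *v (R *v x) = (x :: real^'n)"
  by (simp add: rotation_matrix_def orthogonal_matrix_def matrix_vector_mul_assoc)

lemma same_up_to_motionI: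
  fixes R :: "real^2^2"
  assumes "p \<in> equilibria N" "q \<in> equilibria N" "rotation_matrix R"
    "\<And>a. a \<in> nodes N \<Longrightarrow> q a = R *v p a + t"
  shows "(p, q) \<in> same_up_to_motion N"
  unfolding same_up_to_motion_def mem_Collect_eq prod.case using assms by blast

lemma same_up_to_motionE:
  assumes "(p, q) \<in> same_up_to_motion N"
  obtains R t where "p \<in> equilibria N" "q \<in> equilibria N" "rotation_matrix (R :: real^2^2)"
    "\<And>a. a \<in> nodes N \<Longrightarrow> q a = R *v p a + t"
  using assms unfolding same_up_to_motion_def mem_Collect_eq prod.case by blast

text \<open>Rotations composed with translations form a group; hence the quotient in
  \<open>rigid\<close> consists of genuine equivalence classes.\<close>

lemma equiv_same_up_to_motion: "equiv (equilibria N) (same_up_to_motion N)"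
proof (rule equivI)
  show "same_up_to_motion N \<subseteq> equilibria N \<times> equilibria N"
    by (auto simp: same_up_to_motion_def)
  show "refl_on (equilibria N) (same_up_to_motion N)"
  proof (rule refl_onI)
    fix p assume p: "p \<in> equilibria N"
    show "(p, p) \<in> same_up_to_motion N"
      by (rule same_up_to_motionI[OF p p rotation_matrix_id, of 0]) simp
  qed
  show "sym (same_up_to_motion N)"
  proof (rule symI)
    fix p q assume "(p, q) \<in> same_up_to_motion N"
    then obtain R t where *: "p \<in> equilibria N" "q \<in> equilibria N" "rotation_matrix R"
      "\<And>a. a \<in> nodes N \<Longrightarrow> q a = R *v p a + t"
      by (rule same_up_to_motionE) blast
    have "p a = transpose R *v q a + - (transpose R *v t)" if "a \<in> nodes N" for a
      using *(4)[OF that] *(3)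
      by (simp add: matrix_vector_right_distrib rotation_matrix_transpose_mult
          del: transpose_matrix_vector)
    with *(2,1) rotation_matrix_transpose[OF *(3)] show "(q, p) \<in> same_up_to_motion N"
      by (rule same_up_to_motionI)
  qed
  show "trans (same_up_to_motion N)"
  proof (rule transI)
    fix p q u assume pq: "(p, q) \<in> same_up_to_motion N" and qu: "(q, u) \<in> same_up_to_motion N"
    obtain R t where 1: "p \<in> equilibria N" "rotation_matrix R"
      "\<And>a. a \<in> nodes N \<Longrightarrow> q a = R *v p a + t"
      using pq by (rule same_up_to_motionE) blast
    obtain R' t' where 2: "u \<in> equilibria N" "rotation_matrix R'"
      "\<And>a. a \<in> nodes N \<Longrightarrow> u a = R' *v q a + t'"
      using qu by (rule same_up_to_motionE) blast
    have "u a = (R' ** R) *v p a + (R' *v t + t')" if "a \<in> nodes N" for a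
      using 1(3)[OF that] 2(3)[OF that]
      by (simp add: matrix_vector_right_distrib matrix_vector_mul_assoc)
    with 1(1) 2(1) rotation_matrix_mul[OF 2(2) 1(2)] show "(p, u) \<in> same_up_to_motion N"
      by (rule same_up_to_motionI)
  qed
qed

text \<open>An isolated node \<open>c\<close> neither feels nor exerts a force, so an equilibrium
  survives moving it anywhere. Its distance to another node \<open>b\<close> is invariant under
  motions and takes infinitely many values, giving infinitely many classes.\<close>

lemma rigid_no_isolated_node:
  assumes N: "translational_spring_network N" and "rigid N" and c: "c \<in> nodes N"
  shows "node_degree N c \<noteq> 0"
proof
  assume "node_degree N c = 0"
  then have nb: "neighbours N c = {}" using neighbours_empty_iff[OF N] by simp
  then have c_nb: "c \<notin> neighbours N a" for a using neighbours_sym by blast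
  obtain p where p: "p \<in> equilibria N" using equilibria_nonempty[OF N] by blast
  have "2 \<le> card (nodes N)"
    using N by (simp add: translational_spring_network_def nodes_def)
  then have "\<exists>b \<in> nodes N. b \<noteq> c"
    by (metis card_le_Suc0_iff_eq finite_nodes not_less_eq_eq numeral_2_eq_2)
  then obtain b where b: "b \<in> nodes N" "b \<noteq> c" by blast
  define f where "f = (\<lambda>t :: real. p(c := p b + t *\<^sub>R axis 1 1))"
  define r where "r = same_up_to_motion N"
  have f_eq: "f t \<in> equilibria N" for t
  proof -
    have "(\<forall>d \<in> neighbours N a. f t a \<noteq> f t d) \<and>
        (\<Sum>d \<in> neighbours N a. hooke_force N (f t) a d) = 0" if a: "a \<in> nodes N" for a
    proof (cases "a = c")
      case True
      then show ?thesis using nb by simp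
    next
      case False
      then have same: "f t a = p a" "\<And>d. d \<in> neighbours N a \<Longrightarrow> f t d = p d"
        using c_nb[of a] by (auto simp: f_def)
      then have "(\<Sum>d \<in> neighbours N a. hooke_force N (f t) a d) =
          (\<Sum>d \<in> neighbours N a. hooke_force N p a d)"
        by (intro sum.cong) (auto simp: hooke_force_def)
      then show ?thesis
        using p a same by (simp add: equilibria_def equilibrium_def)
    qed
    then have "equilibrium N (f t)" by (simp add: equilibrium_def)
    then show ?thesis
      using p c by (auto simp: equilibria_def embeddings_def f_def PiE_def extensional_def)
  qed
  have refl: "(f t, f t) \<in> r" for t
    using equiv_class_self[OF equiv_same_up_to_motion f_eq] by (simp add: r_def)
  \<comment> \<open>The distance from \<open>b\<close> to the moved node is the absolute value of
    \<open>t\<close>, which determines \<open>t\<close> only on the nonnegative half-line.\<close>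
  have "inj_on (\<lambda>t. r `` {f t}) {0..}"
  proof (rule inj_onI)
    fix s t :: real assume st: "s \<in> {0..}" "t \<in> {0..}" and "r `` {f s} = r `` {f t}"
    then have "(f s, f t) \<in> r" using refl[of t] by blast
    then obtain R :: "real^2^2" and v where R: "rotation_matrix R"
      and eq: "\<And>a. a \<in> nodes N \<Longrightarrow> f t a = R *v f s a + v"
      unfolding r_def by (rule same_up_to_motionE) blast
    have "f t c - f t b = R *v (f s c - f s b)"
      using eq b c by (simp add: matrix_vector_mult_diff_distrib)
    then have "norm (f t c - f t b) = norm (f s c - f s b)"
      using rotation_matrix_norm[OF R] by simp
    then show "s = t" using b st by (simp add: f_def)
  qed
  moreover have "infinite {0 :: real..}" by (rule infinite_Ici)
  ultimately have "infinite ((\<lambda>t. r `` {f t}) ` {0..})" using finite_imageD by blast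
  moreover have "(\<lambda>t. r `` {f t}) ` {0..} \<subseteq> equilibria N // r"
    using f_eq by (auto simp: quotient_def)
  ultimately show False
    using \<open>rigid N\<close> finite_subset unfolding rigid_def r_def by blast
qed

text \<open>A motion preserves distances and rotates difference vectors, so it rotates all Hooke
  forces by the same \<open>R\<close>.\<close>

lemma equilibrium_motion:
  fixes p :: "nat \<Rightarrow> real^2"
  assumes N: "translational_spring_network N" and R: "rotation_matrix R"
    and p: "equilibrium N p" and q: "\<And>a. a \<in> nodes N \<Longrightarrow> q a = R *v p a + t"
  shows "equilibrium N q"
  unfolding equilibrium_def
proof (intro ballI conjI)
  fix a assume a: "a \<in> nodes N"
  have diff: "q b - q a = R *v (p b - p a)" if "b \<in> neighbours N a" for b
    using that q[OF a] q[of b] neighbours_subset_nodes[OF N, of a]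
    by (auto simp: matrix_vector_mult_diff_distrib)
  have dist: "dist (q a) (q b) = dist (p a) (p b)" if "b \<in> neighbours N a" for b
    using diff[OF that] rotation_matrix_norm[OF R]
    by (metis dist_commute dist_norm)
  show "q a \<noteq> q b" if "b \<in> neighbours N a" for b
    using dist[OF that] p a that by (auto simp: equilibrium_def)
  have "hooke_force N q a b = R *v hooke_force N p a b" if "b \<in> neighbours N a" for b
    using dist[OF that] diff[OF that] by (simp add: hooke_force_def matrix_vector_mult_scaleR)
  then have "(\<Sum>b \<in> neighbours N a. hooke_force N q a b) =
      (\<Sum>b \<in> neighbours N a. R *v hooke_force N p a b)" by simp
  also have "\<dots> = R *v (\<Sum>b \<in> neighbours N a. hooke_force N p a b)"
    by (simp add: linear_sum[OF matrix_vector_mul_linear])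
  finally show "(\<Sum>b \<in> neighbours N a. hooke_force N q a b) = 0"
    using p a by (simp add: equilibrium_def)
qed

text \<open>Adjacent nodes are distinct in an equilibrium, so every class has a representative with
  \<open>a\<close> at the origin and \<open>b\<close> on the positive x-axis; the normalised
  equilibria thus cover all classes.\<close>

lemma rigid_if_finite_normalised:
  assumes N: "translational_spring_network N" and ab: "a \<in> nodes N" "b \<in> neighbours N a"
    and fin: "finite {q \<in> equilibria N. q a = 0 \<and> q b $ 2 = 0 \<and> q b $ 1 > 0}" (is "finite ?E")
  shows "rigid N"
proof -
  let ?r = "same_up_to_motion N"
  have b: "b \<in> nodes N" using ab neighbours_subset_nodes[OF N] by blast
  have "\<exists>q \<in> ?E. (p, q) \<in> ?r" if p: "p \<in> equilibria N" for p
  proof -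
    define v where "v = p b - p a"
    have "v \<noteq> 0" using p ab by (fastforce simp: v_def equilibria_def equilibrium_def)
    \<comment> \<open>Dimension at least 2 guarantees an orthogonal map of determinant 1 that takes
      a basis vector to a given unit vector.\<close>
    then have "norm ((1 / norm v) *\<^sub>R v) = 1" "2 \<le> CARD(2)" by simp_all
    then obtain A :: "real^2^2" where A: "rotation_matrix A" "A *v axis 1 1 = (1 / norm v) *\<^sub>R v"
      using rotation_matrix_exists_basis[of "(1 / norm v) *\<^sub>R v"] by blast
    \<comment> \<open>\<open>A\<close> turns the x-axis towards \<open>v\<close>, so its transpose
      turns \<open>v\<close> back onto the x-axis.\<close>
    define R where "R = transpose A"
    define q where "q = restrict (\<lambda>c. R *v p c + - (R *v p a)) (nodes N)"
    have R: "rotation_matrix R" unfolding R_def by (rule rotation_matrix_transpose[OF A(1)])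
    have "v = norm v *\<^sub>R (A *v axis 1 1)" using A(2) \<open>v \<noteq> 0\<close> by simp
    then have "R *v v = norm v *\<^sub>R axis 1 1"
      using rotation_matrix_transpose_mult[OF A(1)]
      by (metis R_def matrix_vector_mult_scaleR)
    then have "R *v p b - R *v p a = norm v *\<^sub>R axis 1 1"
      by (simp add: v_def matrix_vector_mult_diff_distrib)
    then have q_ab: "q a = 0" "q b = norm v *\<^sub>R axis 1 1"
      using ab b by (simp_all add: q_def)
    have "equilibrium N q"
      by (rule equilibrium_motion[OF N R, of p]) (use p in \<open>auto simp: equilibria_def q_def\<close>)
    then have q: "q \<in> equilibria N" by (auto simp: equilibria_def embeddings_def q_def)
    have "(p, q) \<in> ?r"
      using p q R by (rule same_up_to_motionI) (simp add: q_def)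
    moreover have "q \<in> ?E"
      using q q_ab \<open>v \<noteq> 0\<close> by (simp add: axis_def)
    ultimately show ?thesis by blast
  qed
  then have "equilibria N // ?r \<subseteq> (\<lambda>q. ?r `` {q}) ` ?E"
    using equiv_class_eq[OF equiv_same_up_to_motion] by (fastforce simp: quotient_def)
  then show ?thesis unfolding rigid_def using fin by (meson finite_imageI finite_subset)
qed

section \<open>A rigid network with nodes of different degrees\<close>

declare One_nat_def [simp del]

text \<open>The complete graph on four nodes without the edge between 3 and 4, with unit parameters.\<close>

definition diamond :: spring_network where
  "diamond = \<lparr>num_nodes = 4, springs = {{1, 2}, {1, 3}, {2, 3}, {1, 4}, {2, 4}},
     spring_const = \<lambda>_. 1, rest_length = \<lambda>_. 1\<rparr>"

lemma nodes_diamond: "nodes diamond = {1, 2, 3, 4}"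
  by (auto simp: nodes_def diamond_def)

lemma diamond_network: "translational_spring_network diamond"
proof -
  have "{{1, 2}, {1, 3}, {2, 3}, {1, 4}, {2, 4}} \<subseteq>
      {{a, b} | a b :: nat. 1 \<le> a \<and> a < b \<and> b \<le> 4}"
    unfolding insert_subset mem_Collect_eq
    by (intro conjI empty_subsetI) (rule exI, rule exI, rule conjI, rule refl, simp)+
  then show ?thesis by (simp add: translational_spring_network_def diamond_def)
qed

lemma neighbours_diamond:
  "neighbours diamond 1 = {2, 3, 4}" "neighbours diamond 2 = {1, 3, 4}"
  "neighbours diamond 3 = {1, 2}" "neighbours diamond 4 = {1, 2}"
  by (auto simp: neighbours_def diamond_def doubleton_eq_iff)

lemma node_degree_diamond:
  "node_degree diamond 1 = 3" "node_degree diamond 2 = 3"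
  "node_degree diamond 3 = 2" "node_degree diamond 4 = 2"
  by (simp_all flip: card_neighbours[OF diamond_network] add: neighbours_diamond)

text \<open>A node \<open>(x, y)\<close> attached by unit springs to \<open>(0, 0)\<close> and \<open>(L, 0)\<close>: off the axis both
  springs must be relaxed; on the axis, the sign pattern of \<open>x\<close> and \<open>x - L\<close> determines \<open>x\<close>. In
  each case the force \<open>(1 - 1 / sqrt (x\<^sup>2 + y\<^sup>2)) * x\<close> on the origin is affine in \<open>L\<close>.\<close>

lemma wing_position:
  fixes x y L :: real
  defines "\<alpha> \<equiv> 1 - 1 / sqrt (x\<^sup>2 + y\<^sup>2)" and "\<beta> \<equiv> 1 - 1 / sqrt ((x - L)\<^sup>2 + y\<^sup>2)"
  assumes L: "L > 0" and ne: "x \<noteq> 0 \<or> y \<noteq> 0" "x \<noteq> L \<or> y \<noteq> 0"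
    and fx: "\<alpha> * x + \<beta> * (x - L) = 0" and fy: "\<alpha> * y + \<beta> * y = 0"
  shows "x \<in> {L / 2 - 1, L / 2, L / 2 + 1}" "y\<^sup>2 \<in> {0, 1 - L\<^sup>2 / 4}"
    "\<alpha> * x \<in> {0, L / 2, L / 2 - 1}"
proof -
  have "x \<in> {L / 2 - 1, L / 2, L / 2 + 1} \<and> y\<^sup>2 \<in> {0, 1 - L\<^sup>2 / 4} \<and> \<alpha> * x \<in> {0, L / 2, L / 2 - 1}"
  proof (cases "y = 0")
    case False
    then have "\<alpha> + \<beta> = 0" using fy by (metis distrib_right mult_eq_0_iff)
    then have "\<beta> = - \<alpha>" by simp
    \<comment> \<open>With opposite coefficients the horizontal balance loses \<open>x\<close> and
      forces both springs to have their rest length 1.\<close>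
    then have "\<alpha> * L = 0" using fx by (simp add: algebra_simps)
    then have "\<alpha> = 0" "\<beta> = 0" using L \<open>\<beta> = - \<alpha>\<close> by simp_all
    then have "sqrt (x\<^sup>2 + y\<^sup>2) = 1" "sqrt ((x - L)\<^sup>2 + y\<^sup>2) = 1"
      unfolding \<alpha>_def \<beta>_def by (auto simp: field_simps split: if_splits)
    then have 1: "x\<^sup>2 + y\<^sup>2 = 1" and 2: "(x - L)\<^sup>2 + y\<^sup>2 = 1" by simp_all
    then have "L * (L - 2 * x) = 0" by (simp add: power2_eq_square algebra_simps)
    then have "x = L / 2" using L by simp
    moreover have "y\<^sup>2 = 1 - L\<^sup>2 / 4"
    proof -
      have "x\<^sup>2 = L\<^sup>2 / 4" unfolding \<open>x = L / 2\<close> by (simp add: power_divide)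
      then show ?thesis using 1 by simp
    qed
    ultimately show ?thesis using \<open>\<alpha> = 0\<close> by simp
  next
    case True
    \<comment> \<open>On the axis the spring length is the absolute value of \<open>x\<close>, so
      the second term of the force is a sign.\<close>
    have ax: "\<alpha> * x = x - sgn x"
      unfolding \<alpha>_def True using ne(1) True by (simp add: algebra_simps real_sgn_eq)
    have bx: "\<beta> * (x - L) = (x - L) - sgn (x - L)"
      unfolding \<beta>_def True using ne(2) True by (simp add: algebra_simps real_sgn_eq)
    have eq: "2 * x = L + sgn x + sgn (x - L)" using fx ax bx by simp
    consider "x < 0" | "0 < x" "x < L" | "L < x" using ne True L by fastforce
    then show ?thesis
      using eq L True by cases (simp_all add: ax sgn_if)
  qed
  then show "x \<in> {L / 2 - 1, L / 2, L / 2 + 1}" "y\<^sup>2 \<in> {0, 1 - L\<^sup>2 / 4}"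
    "\<alpha> * x \<in> {0, L / 2, L / 2 - 1}" by blast+
qed

section \<open>Equilibrium positions of the diamond and its Bezout bounds\<close>

lemma dist_real2: "dist p q = sqrt ((p $ 1 - q $ 1)\<^sup>2 + (p $ 2 - q $ 2)\<^sup>2)" for p q :: "real^2"
  by (simp add: dist_vec_def L2_set_def sum_2 dist_real_def)

lemma real2_eq_iff: "p = q \<longleftrightarrow> p $ 1 = q $ 1 \<and> p $ 2 = q $ 2" for p q :: "real^2"
  by (simp add: vec_eq_iff forall_2)

lemma hooke_force_diamond:
  assumes "p a \<noteq> p b"
  shows "hooke_force diamond p a b $ i = (1 - 1 / dist (p a) (p b)) * (p b $ i - p a $ i)"
  using assms by (simp add: hooke_force_def diamond_def field_simps)

text \<open>The horizontal balance at node 1 reads \<open>L - 1 + t + t' = 0\<close>, where the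
  wings contribute \<open>t\<close> and \<open>t'\<close> from 0, \<open>L / 2\<close> and
  \<open>L / 2 - 1\<close>. Up to symmetry these are six linear equations for \<open>L\<close>, two
  of which have the solution 1.\<close>

lemma diamond_normalised_position:
  assumes p: "p \<in> equilibria diamond" and p1: "p 1 = 0" and p2: "p 2 $ 2 = 0"
    and L: "p 2 $ 1 = L" "L > 0"
  shows "L \<in> {1, 2 / 3, 1 / 2, 4 / 3, 3 / 2}"
    and "a \<in> {3, 4} \<Longrightarrow> p a $ 1 \<in> {L / 2 - 1, L / 2, L / 2 + 1} \<and> (p a $ 2)\<^sup>2 \<in> {0, 1 - L\<^sup>2 / 4}"
proof -
  define \<alpha> where "\<alpha> = (\<lambda>a. 1 - 1 / sqrt ((p a $ 1)\<^sup>2 + (p a $ 2)\<^sup>2))"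
  have eq: "(\<And>b. b \<in> neighbours diamond a \<Longrightarrow> p a \<noteq> p b)"
    "(\<Sum>b \<in> neighbours diamond a. hooke_force diamond p a b) = 0" if "a \<in> {1, 2, 3, 4}" for a
    using p that unfolding equilibria_def equilibrium_def mem_Collect_eq nodes_diamond by blast+
  have wing: "p a $ 1 \<in> {L / 2 - 1, L / 2, L / 2 + 1}" "(p a $ 2)\<^sup>2 \<in> {0, 1 - L\<^sup>2 / 4}"
    "\<alpha> a * p a $ 1 \<in> {0, L / 2, L / 2 - 1}" if a: "a \<in> {3, 4}" for a
  proof -
    have nb: "neighbours diamond a = {1, 2}" using a neighbours_diamond by auto
    then have ne: "p a \<noteq> p 1" "p a \<noteq> p 2" using eq(1)[of a] a by auto
    define \<beta> where "\<beta> = 1 - 1 / sqrt ((p a $ 1 - L)\<^sup>2 + (p a $ 2)\<^sup>2)"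
    have "hooke_force diamond p a 1 $ i + hooke_force diamond p a 2 $ i = 0" for i
    proof -
      have "hooke_force diamond p a 1 + hooke_force diamond p a 2 = 0"
        using eq(2)[of a] a nb by auto
      then show ?thesis by (metis vector_add_component zero_index)
    qed
    then have f: "\<alpha> a * (0 - p a $ i) + \<beta> * (p 2 $ i - p a $ i) = 0" for i
      using ne p1 p2 L by (simp add: hooke_force_diamond dist_real2 \<alpha>_def \<beta>_def)
    have "\<alpha> a * p a $ 1 + \<beta> * (p a $ 1 - L) = 0" "\<alpha> a * p a $ 2 + \<beta> * p a $ 2 = 0"
      using f[of 1] f[of 2] L p2 by (simp_all add: algebra_simps)
    moreover have "p a $ 1 \<noteq> 0 \<or> p a $ 2 \<noteq> 0" "p a $ 1 \<noteq> L \<or> p a $ 2 \<noteq> 0"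
      using ne p1 p2 L by (auto simp: real2_eq_iff)
    ultimately show "p a $ 1 \<in> {L / 2 - 1, L / 2, L / 2 + 1}" "(p a $ 2)\<^sup>2 \<in> {0, 1 - L\<^sup>2 / 4}"
      "\<alpha> a * p a $ 1 \<in> {0, L / 2, L / 2 - 1}"
      unfolding \<alpha>_def \<beta>_def using wing_position[of L "p a $ 1" "p a $ 2"] L(2) by blast+
  qed
  show "p a $ 1 \<in> {L / 2 - 1, L / 2, L / 2 + 1} \<and> (p a $ 2)\<^sup>2 \<in> {0, 1 - L\<^sup>2 / 4}" if "a \<in> {3, 4}"
    using wing[OF that] by blast
  have ne: "p 1 \<noteq> p 2" "p 1 \<noteq> p 3" "p 1 \<noteq> p 4"
    using eq(1)[of 1] by (auto simp: neighbours_diamond)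
  have "(\<Sum>b \<in> {2, 3, 4}. hooke_force diamond p 1 b) = 0"
    using eq(2)[of 1] by (simp add: neighbours_diamond)
  then have "hooke_force diamond p 1 2 + hooke_force diamond p 1 3 + hooke_force diamond p 1 4 = 0"
    by (simp add: add.assoc)
  then have "hooke_force diamond p 1 2 $ 1 + hooke_force diamond p 1 3 $ 1 +
      hooke_force diamond p 1 4 $ 1 = 0"
    by (metis vector_add_component zero_index)
  then have "(1 - 1 / L) * L + \<alpha> 3 * p 3 $ 1 + \<alpha> 4 * p 4 $ 1 = 0"
    using ne p1 p2 L by (simp add: hooke_force_diamond dist_real2 \<alpha>_def)
  then have "L - 1 + \<alpha> 3 * p 3 $ 1 + \<alpha> 4 * p 4 $ 1 = 0"
    using L by (simp add: algebra_simps)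
  then show "L \<in> {1, 2 / 3, 1 / 2, 4 / 3, 3 / 2}"
    using wing(3)[of 3] wing(3)[of 4] by auto
qed

lemma rigid_diamond: "rigid diamond"
proof (rule rigid_if_finite_normalised[OF diamond_network])
  show "1 \<in> nodes diamond" "2 \<in> neighbours diamond 1"
    by (simp_all add: nodes_diamond neighbours_diamond)
  define Ls :: "real set" where "Ls = {1, 2 / 3, 1 / 2, 4 / 3, 3 / 2}"
  \<comment> \<open>The values 0 and \<open>Ls\<close> account for nodes 1 and 2, the remaining ones
    for the wing nodes 3 and 4.\<close>
  define xs where "xs = {0} \<union> Ls \<union> (\<Union>L \<in> Ls. {L / 2 - 1, L / 2, L / 2 + 1})"
  define ys where "ys = {0} \<union> (\<Union>L \<in> Ls. {sqrt (1 - L\<^sup>2 / 4), - sqrt (1 - L\<^sup>2 / 4)})"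
  define S where "S = (\<lambda>(x, y). vector [x, y] :: real^2) ` (xs \<times> ys)"
  have "finite S" by (simp add: S_def xs_def ys_def Ls_def)
  have S: "v \<in> S" if "v $ 1 \<in> xs" "v $ 2 \<in> ys" for v
  proof -
    have "v = vector [v $ 1, v $ 2]" by (simp add: real2_eq_iff)
    then have "v = (\<lambda>(x, y). vector [x, y]) (v $ 1, v $ 2)" by simp
    then show ?thesis unfolding S_def by (rule image_eqI) (use that in simp)
  qed
  have "{q \<in> equilibria diamond. q 1 = 0 \<and> q 2 $ 2 = 0 \<and> q 2 $ 1 > 0} \<subseteq> nodes diamond \<rightarrow>\<^sub>E S"
  proof
    fix p assume "p \<in> {q \<in> equilibria diamond. q 1 = 0 \<and> q 2 $ 2 = 0 \<and> q 2 $ 1 > 0}"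
    then have p: "p \<in> equilibria diamond" "p 1 = 0" "p 2 $ 2 = 0" "p 2 $ 1 > 0" by auto
    define L where "L = p 2 $ 1"
    note pos = diamond_normalised_position[OF p(1-3) L_def[symmetric]]
    have "L > 0" using p by (simp add: L_def)
    then have L: "L \<in> Ls" using pos(1) by (simp add: Ls_def)
    have "p a \<in> S" if a: "a \<in> {3, 4}" for a
    proof (rule S)
      show "p a $ 1 \<in> xs" using pos(2)[OF \<open>L > 0\<close> a] L unfolding xs_def by blast
      have "p a $ 2 = 0 \<or> \<bar>p a $ 2\<bar> = sqrt (1 - L\<^sup>2 / 4)"
        using pos(2)[OF \<open>L > 0\<close> a] by (metis empty_iff insert_iff power_eq_0_iff real_sqrt_abs)
      then have "p a $ 2 \<in> {0, sqrt (1 - L\<^sup>2 / 4), - sqrt (1 - L\<^sup>2 / 4)}" by auto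
      then show "p a $ 2 \<in> ys" using L unfolding ys_def by blast
    qed
    moreover have "p 1 \<in> S" "p 2 \<in> S"
      using p L by (auto intro!: S simp: xs_def ys_def L_def)
    ultimately show "p \<in> nodes diamond \<rightarrow>\<^sub>E S"
      using p(1) by (auto simp: equilibria_def embeddings_def nodes_diamond PiE_def)
  qed
  then show "finite {q \<in> equilibria diamond. q 1 = 0 \<and> q 2 $ 2 = 0 \<and> q 2 $ 1 > 0}"
    using \<open>finite S\<close> finite_PiE[of "nodes diamond" "\<lambda>_. S"] by (meson finite_nodes finite_subset)
qed

text \<open>Apart from the common factor 2^5, the bounds are (4*3*3)*(3*3) = 324 and (4*4*3)*(4*4) =
  768.\<close>

lemma B_standard_diamond_differs: "B_standard diamond 1 2 \<noteq> B_standard diamond 3 4"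
proof -
  have bp: "(1, 2) \<in> base_pairs diamond" "(3, 4) \<in> base_pairs diamond"
    by (simp_all add: base_pairs_def nodes_diamond)
  have d: "std_force_degree diamond 1 = 4" "std_force_degree diamond 2 = 4"
     "std_force_degree diamond 3 = 3" "std_force_degree diamond 4 = 3"
    by (simp_all add: std_force_degree_def node_degree_diamond)
  have V: "nodes diamond - {1} = {2, 3, 4}" "nodes diamond - {1, 2} = {3, 4}"
    "nodes diamond - {3} = {1, 2, 4}" "nodes diamond - {3, 4} = {1, 2}"
    by (auto simp: nodes_diamond)
  show ?thesis
    unfolding B_standard_eq[OF diamond_network bp(1)] B_standard_eq[OF diamond_network bp(2)] V
    by (simp add: d)
qed

theorem theorem2p4:
  shows "(\<exists>N. translational_spring_network N \<and> rigid N \<and>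
            (\<exists>(i, j) \<in> base_pairs N. \<exists>(i', j') \<in> base_pairs N.
               B_standard N i j \<noteq> B_standard N i' j')) \<and>
         (\<forall>N. translational_spring_network N \<and> rigid N \<longrightarrow>
            (\<forall>(i, j) \<in> base_pairs N.
               (\<forall>a \<in> nodes N. node_degree N a \<le> node_degree N i) \<and>
               (\<forall>a \<in> nodes N - {i}. node_degree N a \<le> node_degree N j) \<longrightarrow>
               (\<forall>(i', j') \<in> base_pairs N. B_standard N i j \<le> B_standard N i' j'))) \<and>
         (\<forall>N. translational_spring_network N \<and> rigid N \<longrightarrow>
            (\<forall>(i, j) \<in> base_pairs N. \<forall>(i', j') \<in> base_pairs N.
               B_inverse N i j = B_inverse N i' j'))"
proof (intro conjI allI impI)
  have "(1, 2) \<in> base_pairs diamond" "(3, 4) \<in> base_pairs diamond"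
    by (simp_all add: base_pairs_def nodes_diamond)
  then show "\<exists>N. translational_spring_network N \<and> rigid N \<and>
      (\<exists>(i, j) \<in> base_pairs N. \<exists>(i', j') \<in> base_pairs N. B_standard N i j \<noteq> B_standard N i' j')"
    using diamond_network rigid_diamond B_standard_diamond_differs by blast
next
  fix N assume N: "translational_spring_network N \<and> rigid N"
  show "\<forall>(i, j) \<in> base_pairs N.
      (\<forall>a \<in> nodes N. node_degree N a \<le> node_degree N i) \<and>
      (\<forall>a \<in> nodes N - {i}. node_degree N a \<le> node_degree N j) \<longrightarrow>
      (\<forall>(i', j') \<in> base_pairs N. B_standard N i j \<le> B_standard N i' j')"
    using N B_standard_minimal by blast
  show "\<forall>(i, j) \<in> base_pairs N. \<forall>(i', j') \<in> base_pairs N. B_inverse N i j = B_inverse N i' j'"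
    using N B_inverse_eq rigid_no_isolated_node by fastforce
qed

end
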